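(* Let $X$ be a standard Borel space and let $E$ be an aperiodic hyperfinite equivalence relation on $X$. Let $n,k\geq 1$ be integers. Then for any Borel almost transitive $E$-coloring $c:[X]^n_E\to\{1,\dots,k\}$, there is a Borel monochromatic reduction $S:X\to X^{\mathbb{N}}$ to $E_1$ for $c$.
   Context: An equivalence relation $E$ on a standard Borel space $X$ is a Borel equivalence relation if $E$ is a Borel subset of $X^2$; it is countable if every $E$-class is countable, finite if every $E$-class is finite, and aperiodic if every $E$-class is infinite. $E$ is hyperfinite if there is an increasing sequence $\{F_i\}_{i\in\mathbb{N}}$ of finite Borel equivalence relations on $X$ with $E=\bigcup_i F_i$. $[x]_E$ denotes the $E$-class of $x$, and $[A]_E$ the $E$-saturation of $A\subseteq X$. For an integer $n>0$, $[X]^n$ is the set of $n$-element subsets of $X$, and $[X]^n_E=\{A\in[X]^n: \exists x\in X\ (A\subseteq [x]_E)\}$. Fixing a Borel linear ordering $<$ of $X$ and listing the elements of each $A\in[X]^n$ in $<$-increasing order identifies $[X]^n_E$ with a Borel subset of $X^n$, so it is a standard Borel space. An $E$-coloring (of dimension $n$ by $k$ many colors) is a function $c:[X]^n_E\to\{1,\dots,k\}$; it is a Borel $E$-coloring if it is Borel. An $E$-coloring $c:[X]^n_E\to\{1,\dots,k\}$ is almost transitive if for any integer $m\geq n$, any $A\in[X]^m_E$ and any $B_1,B_2\in[A]^{n-1}$ (the $(n-1)$-element subsets of $A$), we have $c(\{z\}\cup B_1)=c(\{z\}\cup B_2)$ for all but finitely many $z\in[A]_E\setminus(B_1\cup B_2)$.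 $E_1$ denotes the equivalence relation of eventual equality on $X^{\mathbb{N}}$: $u\,E_1\,v\iff \exists i\ \forall j\geq i\ u(j)=v(j)$. Given an $E$-coloring $c:[X]^n_E\to\{1,\dots,k\}$, a function $S:X\to X^{\mathbb{N}}$ is a monochromatic reduction to $E_1$ for $c$ if: (1) for any $x\in X$ and distinct $i,j\in\mathbb{N}$, $S(x)(i)\neq S(x)(j)$; (2) for any $x\in X$, the set $\{S(x)(i): i\in\mathbb{N}\}$ is a monochromatic subset of $[x]_E$, i.e. it is contained in $[x]_E$ and $c$ is constant on its $n$-element subsets; (3) for any $x,y\in X$, $xEy$ iff $S(x)\,E_1\,S(y)$. *)

theory Defs
  imports "HOL-Analysis.Analysis" "HOL-Library.Ramsey"
begin

text \<open>
  Borel structures are represented by the type of measures; only \<^const>\<open>space\<close> and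
  \<^const>\<open>sets\<close> matter, never the measure itself.
\<close>

definition polish_topology :: "'a topology \<Rightarrow> bool" where
  "polish_topology T \<longleftrightarrow> completely_metrizable_space T \<and> separable_space T"

definition standard_borel :: "'a measure \<Rightarrow> bool" where
  "standard_borel M \<longleftrightarrow>
     (\<exists>T. polish_topology T \<and> topspace T = space M \<and>
          sets M = sigma_sets (space M) {U. openin T U})"

definition borel_equiv :: "'a measure \<Rightarrow> 'a rel \<Rightarrow> bool" where
  "borel_equiv M E \<longleftrightarrow> equiv (space M) E \<and> E \<in> sets (M \<Otimes>\<^sub>M M)"

definition finite_classes :: "'a set \<Rightarrow> 'a rel \<Rightarrow> bool" where
  "finite_classes X E \<longleftrightarrow> (\<forall>x\<in>X. finite (E `` {x}))"

definition aperiodic :: "'a set \<Rightarrow> 'a rel \<Rightarrow> bool" where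
  "aperiodic X E \<longleftrightarrow> (\<forall>x\<in>X. infinite (E `` {x}))"

definition hyperfinite :: "'a measure \<Rightarrow> 'a rel \<Rightarrow> bool" where
  "hyperfinite M E \<longleftrightarrow> borel_equiv M E \<and>
     (\<exists>F :: nat \<Rightarrow> 'a rel. incseq F \<and>
        (\<forall>i. borel_equiv M (F i) \<and> finite_classes (space M) (F i)) \<and>
        E = (\<Union>i. F i))"

definition borel_linear_order :: "'a measure \<Rightarrow> 'a rel \<Rightarrow> bool" where
  "borel_linear_order M R \<longleftrightarrow>
     strict_linear_order_on (space M) R \<and> R \<in> sets (M \<Otimes>\<^sub>M M)"

definition class_nsets :: "'a set \<Rightarrow> 'a rel \<Rightarrow> nat \<Rightarrow> 'a set set" where
  "class_nsets X E n = {A \<in> nsets X n. \<exists>x\<in>X. A \<subseteq> E `` {x}}"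

text \<open>
  The \<open>R\<close>-increasing listing of an \<open>n\<close>-element set: the entry with index \<open>i\<close> is the
  element having exactly \<open>i\<close> predecessors in \<open>A\<close>. The restriction to \<open>{..<n}\<close> makes it
  a point of the product space \<open>X\<^sup>n\<close>, whose points are extensional functions.
\<close>

definition incr_list :: "'a rel \<Rightarrow> nat \<Rightarrow> 'a set \<Rightarrow> nat \<Rightarrow> 'a" where
  "incr_list R n A = (\<lambda>i\<in>{..<n}. THE x. x \<in> A \<and> card {y \<in> A. (y, x) \<in> R} = i)"

text \<open>
  The Borel structure on the \<open>n\<close>-subsets of classes obtained by identifying each of them
  with its increasing listing, i.e. pulled back from \<open>X\<^sup>n\<close> along the injection
  \<^term>\<open>incr_list R n\<close>.
\<close>

definition class_nsets_space :: "'a measure \<Rightarrow> 'a rel \<Rightarrow> 'a rel \<Rightarrow> nat \<Rightarrow> 'a set measure" where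
  "class_nsets_space M R E n =
     vimage_algebra (class_nsets (space M) E n) (incr_list R n) (Pi\<^sub>M {..<n} (\<lambda>_. M))"

lemma incr_list_bij_betw:
  assumes R: "strict_linear_order_on X R" and A: "A \<in> nsets X n"
  shows "bij_betw (incr_list R n A) {..<n} A"
    and "\<And>i j. i < j \<Longrightarrow> j < n \<Longrightarrow> (incr_list R n A i, incr_list R n A j) \<in> R"
proof -
  define r where "r x = card {y \<in> A. (y, x) \<in> R}" for x
  have A': "A \<subseteq> X" "finite A" "card A = n"
    using A by (auto simp: nsets_def)
  have tr: "trans R" and ir: "irrefl R" and tot: "total_on X R"
    using R by (auto simp: strict_linear_order_on_def)
  have mono: "r x < r y" if "x \<in> A" "y \<in> A" "(x, y) \<in> R" for x y
    unfolding r_def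
  proof (rule psubset_card_mono)
    show "finite {z \<in> A. (z, y) \<in> R}" using A' by simp
    have "x \<in> {z \<in> A. (z, y) \<in> R}" "x \<notin> {z \<in> A. (z, x) \<in> R}"
      using that ir by (auto simp: irrefl_def)
    moreover have "{z \<in> A. (z, x) \<in> R} \<subseteq> {z \<in> A. (z, y) \<in> R}"
      using that tr by (auto dest: transD)
    ultimately show "{z \<in> A. (z, x) \<in> R} \<subset> {z \<in> A. (z, y) \<in> R}" by blast
  qed
  have inj: "inj_on r A"
  proof (rule inj_onI, rule ccontr)
    fix x y assume *: "x \<in> A" "y \<in> A" "r x = r y" "x \<noteq> y"
    then have "(x, y) \<in> R \<or> (y, x) \<in> R"
      using tot A' by (auto simp: total_on_def)
    then show False using mono * by force
  qed
  have "r ` A \<subseteq> {..<n}"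
  proof safe
    fix x assume "x \<in> A"
    then have "{y \<in> A. (y, x) \<in> R} \<subset> A" using ir by (auto simp: irrefl_def)
    then show "r x < n" unfolding r_def using A' psubset_card_mono by blast
  qed
  then have "r ` A = {..<n}"
    using A' inj by (intro card_subset_eq) (auto simp: card_image)
  then have bij: "bij_betw r A {..<n}" using inj by (simp add: bij_betw_def)
  have eq: "incr_list R n A i = the_inv_into A r i" if "i < n" for i
    using that by (simp add: incr_list_def the_inv_into_def r_def)
  show "bij_betw (incr_list R n A) {..<n} A"
    using bij_betw_the_inv_into[OF bij] by (rule bij_betw_cong[THEN iffD1, rotated]) (simp add: eq)
  fix i j assume ij: "i < j" "j < n"
  define x y where "x = the_inv_into A r i" and "y = the_inv_into A r j"
  have xy: "x \<in> A" "y \<in> A" "r x = i" "r y = j"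
    using ij bij unfolding x_def y_def
    by (auto simp: bij_betw_def f_the_inv_into_f intro!: the_inv_into_into)
  then have "x \<noteq> y" using ij by auto
  then have "(x, y) \<in> R \<or> (y, x) \<in> R" using tot A' xy by (auto simp: total_on_def)
  then have "(x, y) \<in> R" using mono[of y x] xy ij by auto
  then show "(incr_list R n A i, incr_list R n A j) \<in> R"
    using ij by (simp add: eq x_def y_def)
qed

definition borel_coloring ::
  "'a measure \<Rightarrow> 'a rel \<Rightarrow> 'a rel \<Rightarrow> nat \<Rightarrow> nat \<Rightarrow> ('a set \<Rightarrow> nat) \<Rightarrow> bool" where
  "borel_coloring M R E n k c \<longleftrightarrow>
     c \<in> class_nsets_space M R E n \<rightarrow>\<^sub>M count_space {1..k}"

definition almost_transitive :: "'a set \<Rightarrow> 'a rel \<Rightarrow> nat \<Rightarrow> ('a set \<Rightarrow> nat) \<Rightarrow> bool" where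
  "almost_transitive X E n c \<longleftrightarrow>
     (\<forall>m\<ge>n. \<forall>A \<in> class_nsets X E m. \<forall>B1 \<in> nsets A (n - 1). \<forall>B2 \<in> nsets A (n - 1).
        finite {z \<in> E `` A - (B1 \<union> B2). c ({z} \<union> B1) \<noteq> c ({z} \<union> B2)})"

definition E1 :: "'a set \<Rightarrow> (nat \<Rightarrow> 'a) rel" where
  "E1 X = {(u, v). u \<in> UNIV \<rightarrow> X \<and> v \<in> UNIV \<rightarrow> X \<and> (\<exists>i. \<forall>j\<ge>i. u j = v j)}"

definition monochromatic_reduction ::
  "'a set \<Rightarrow> 'a rel \<Rightarrow> nat \<Rightarrow> ('a set \<Rightarrow> nat) \<Rightarrow> ('a \<Rightarrow> nat \<Rightarrow> 'a) \<Rightarrow> bool" where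
  "monochromatic_reduction X E n c S \<longleftrightarrow>
     S \<in> X \<rightarrow> (UNIV \<rightarrow> X) \<and>
     (\<forall>x\<in>X. \<forall>i j. i \<noteq> j \<longrightarrow> S x i \<noteq> S x j) \<and>
     (\<forall>x\<in>X. range (S x) \<subseteq> E `` {x} \<and>
        (\<forall>B \<in> nsets (range (S x)) n. \<forall>B' \<in> nsets (range (S x)) n. c B = c B')) \<and>
     (\<forall>x\<in>X. \<forall>y\<in>X. (x, y) \<in> E \<longleftrightarrow> (S x, S y) \<in> E1 X)"

end

(*
  Almost transitivity provides for every E-class a colour q such that each finite subset P of the
  class admits infinitely many points z of the class for which all sets {z} Un B, with B an
  (n-1)-subset of P, have colour q. If E is the increasing union of the finite relations F i, then
  at stage i every F i-class chooses such a point, with P containing all points that its members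
  chose at earlier stages. The sequence of points chosen by the F i-classes of x is injective and
  homogeneous, and E-equivalent points eventually make the same choices.

  For measurability, quantifiers over E-classes have to be replaced by countable ones. This needs a
  Borel enumeration of the classes of a finite Borel equivalence relation, hence the Borelness of
  projections of Borel sets with finite sections. Since finite sections are compact, the latter
  follows from Novikov's separation theorem for countable families of analytic sets.
*)

theory Submission
  imports Defs
begin

text \<open>Every \<open>n\<close>-subset of the final sequence has a member that was chosen last,
  so it is enough to control the colours that a new point produces together with
  \<open>(n - 1)\<close>-sets of earlier points. The colour has to be fixed before the first choice
  and has to agree on equivalent points; the least suitable colour is such an invariant, and it is
  Borel. Passing from \<open>F i\<close> to \<open>F (Suc i)\<close> merges classes with different
  histories. The new point is shared by all members, while each keeps its own earlier points, so it
  must suit all these histories at once. Finiteness of the \<open>F i\<close>-classes keeps their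
  union finite, within the reach of almost transitivity. It also makes the saturations of Borel sets
  projections with finite sections, and \<open>E\<close> inherits its enumeration of classes from
  the \<open>F i\<close>.\<close>

section \<open>Analytic sets and separation\<close>

text \<open>
  Closed subsets of \<open>nat \<Rightarrow> real\<close> serve as parameter spaces in place of the Baire space, so
  that closed sets of real sequences are trivially analytic.
\<close>

definition analytic :: "'b::topological_space set \<Rightarrow> bool" where
  "analytic A \<longleftrightarrow>
     (\<exists>(D :: (nat \<Rightarrow> real) set) f. closed D \<and> continuous_on D f \<and> f ` D = A)"

lemma analytic_image:
  assumes "analytic A" "continuous_on A g"
  shows "analytic (g ` A)"
proof -
  obtain D :: "(nat \<Rightarrow> real) set" and f where "closed D" "continuous_on D f" "f ` D = A"
    using assms(1) unfolding analytic_def by blast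
  then show ?thesis
    unfolding analytic_def
    by (intro exI[of _ D] exI[of _ "g \<circ> f"]) (use assms(2) continuous_on_compose in auto)
qed

lemma analytic_closed: "closed A \<Longrightarrow> analytic (A :: (nat \<Rightarrow> real) set)"
  unfolding analytic_def by (intro exI[of _ A] exI[of _ id]) (auto simp: continuous_on_id)

lemma continuous_on_reindex [continuous_intros]:
  "continuous_on S (\<lambda>z :: 'i \<Rightarrow> 'b::topological_space. \<lambda>m. z (h m))"
  by (intro continuous_on_coordinatewise_then_product)
     (rule continuous_on_product_then_coordinatewise[OF continuous_on_id])

text \<open>The even and the odd coordinates of one sequence code a pair of sequences, so the
  preimage of the closed set serves as parameter set.\<close>

lemma analytic_closed_prod:
  assumes "closed (A :: ((nat \<Rightarrow> real) \<times> (nat \<Rightarrow> real)) set)"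
  shows "analytic A"
proof -
  define g :: "(nat \<Rightarrow> real) \<Rightarrow> (nat \<Rightarrow> real) \<times> (nat \<Rightarrow> real)"
    where "g = (\<lambda>z. (\<lambda>m. z (2 * m), \<lambda>m. z (2 * m + 1)))"
  have g: "continuous_on S g" for S
    unfolding g_def by (intro continuous_intros)
  have "g ` (g -` A) = A"
  proof (rule surj_image_vimage_eq, rule surjI)
    show "g (\<lambda>i. if even i then fst p (i div 2) else snd p (i div 2)) = p" for p
      by (simp add: g_def)
  qed
  moreover have "closed (g -` A)"
    using assms g[of UNIV] by (intro closed_vimage) auto
  ultimately show ?thesis
    unfolding analytic_def using g by blast
qed

lemma tendsto_coordinate:
  fixes z :: "nat \<Rightarrow> 'i \<Rightarrow> 'b::topological_space"
  assumes "z \<longlonglongrightarrow> l"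
  shows "(\<lambda>k. z k i) \<longlonglongrightarrow> l i"
  using continuous_on_tendsto_compose[OF continuous_on_product_coordinates[of i] assms] by simp

lemma tendsto_reindex:
  fixes z :: "nat \<Rightarrow> 'i \<Rightarrow> 'b::topological_space"
  assumes "z \<longlonglongrightarrow> l"
  shows "(\<lambda>k m. z k (h m)) \<longlonglongrightarrow> (\<lambda>m. l (h m))"
  using continuous_on_tendsto_compose[OF continuous_on_reindex[of UNIV h] assms] by simp

text \<open>Coordinate 0 of a parameter holds the index \<open>n\<close>, the shifted sequence a
  parameter for \<open>A n\<close>. As the naturals are closed and discrete in the reals, the index
  is eventually constant along a convergent sequence of parameters; this gives both closedness and
  continuity.\<close>

lemma analytic_UN:
  fixes A :: "nat \<Rightarrow> 'b::topological_space set"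
  assumes "\<And>n. analytic (A n)"
  shows "analytic (\<Union>n. A n)"
proof -
  obtain D :: "nat \<Rightarrow> (nat \<Rightarrow> real) set" and f
    where Df: "\<And>n. closed (D n)" "\<And>n. continuous_on (D n) (f n)" "\<And>n. f n ` D n = A n"
    using assms unfolding analytic_def by metis
  define tl where "tl z = (\<lambda>m. z (Suc m))" for z :: "nat \<Rightarrow> real"
  define D' where "D' = {z. \<exists>n. z 0 = real n \<and> tl z \<in> D n}"
  define f' where "f' z = f (nat \<lfloor>z 0\<rfloor>) (tl z)" for z
  have lim: "\<exists>n. l 0 = real n \<and> tl l \<in> D n \<and> (\<lambda>k. tl (z k)) \<longlonglongrightarrow> tl l \<and>
      (\<forall>\<^sub>F k in sequentially. z k 0 = real n \<and> tl (z k) \<in> D n)"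
    if z: "\<And>k. z k \<in> D'" "z \<longlonglongrightarrow> l" for z l
  proof -
    have l0: "(\<lambda>k. z k 0) \<longlonglongrightarrow> l 0" using tendsto_coordinate[OF z(2)] .
    have "closed (range real)" by (rule closed_of_nat_image)
    moreover have "z k 0 \<in> range real" for k using z(1)[of k] by (auto simp: D'_def)
    ultimately have "l 0 \<in> range real" using l0 closed_sequentially by metis
    then obtain n where n: "l 0 = real n" by auto
    have "\<forall>\<^sub>F k in sequentially. dist (z k 0) (l 0) < 1" using l0 by (rule tendstoD) simp
    then have ev: "\<forall>\<^sub>F k in sequentially. z k 0 = real n \<and> tl (z k) \<in> D n"
    proof eventually_elim
      case (elim k)
      obtain m where "z k 0 = real m" "tl (z k) \<in> D m" using z(1)[of k] by (auto simp: D'_def)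
      moreover have "int m = int n" using elim calculation(1) n unfolding dist_real_def by linarith
      ultimately show ?case by simp
    qed
    have t: "(\<lambda>k. tl (z k)) \<longlonglongrightarrow> tl l" unfolding tl_def by (rule tendsto_reindex[OF z(2)])
    have "tl l \<in> D n"
      by (rule Lim_in_closed_set[OF Df(1) _ _ t]) (use ev in \<open>auto elim: eventually_mono\<close>)
    then show ?thesis using n t ev by blast
  qed
  have "closed D'"
    unfolding closed_sequential_limits using lim unfolding D'_def by blast
  moreover have "continuous_on D' f'"
    unfolding continuous_on_sequentially
  proof (intro allI ballI impI)
    fix z l assume l: "l \<in> D'" "(\<forall>k. z k \<in> D') \<and> z \<longlonglongrightarrow> l"
    then obtain n where n: "l 0 = real n" "tl l \<in> D n" "(\<lambda>k. tl (z k)) \<longlonglongrightarrow> tl l"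
      and ev: "\<forall>\<^sub>F k in sequentially. z k 0 = real n \<and> tl (z k) \<in> D n" using lim by blast
    have "(\<lambda>k. f n (tl (z k))) \<longlonglongrightarrow> f n (tl l)"
      by (rule continuous_on_tendsto_compose[OF Df(2) n(3,2)]) (use ev in \<open>auto elim: eventually_mono\<close>)
    moreover have "\<forall>\<^sub>F k in sequentially. f n (tl (z k)) = (f' \<circ> z) k"
      using ev by eventually_elim (auto simp: f'_def)
    ultimately show "(f' \<circ> z) \<longlonglongrightarrow> f' l"
      using n by (auto simp: f'_def intro: Lim_transform_eventually)
  qed
  moreover have "f' ` D' = (\<Union>n. A n)"
  proof (intro equalityI subsetI)
    fix y assume "y \<in> f' ` D'"
    then obtain z n where "y = f n (tl z)" "tl z \<in> D n" by (auto simp: f'_def D'_def)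
    then show "y \<in> (\<Union>n. A n)" using Df(3) by blast
  next
    fix y assume "y \<in> (\<Union>n. A n)"
    then obtain n w where w: "w \<in> D n" "y = f n w" using Df(3) by blast
    define z where "z = case_nat (real n) w"
    have "z \<in> D'" "f' z = y" using w by (auto simp: z_def D'_def f'_def tl_def)
    then show "y \<in> f' ` D'" by blast
  qed
  ultimately show ?thesis unfolding analytic_def by blast
qed

text \<open>One parameter codes a sequence of parameters, one for each \<open>A n\<close>, with the
  same image. Limits being unique in a Hausdorff space, equality of the images is a closed
  condition.\<close>

lemma analytic_INT:
  fixes A :: "nat \<Rightarrow> 'b::t2_space set"
  assumes "\<And>n. analytic (A n)"
  shows "analytic (\<Inter>n. A n)"
proof -
  obtain D :: "nat \<Rightarrow> (nat \<Rightarrow> real) set" and f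
    where Df: "\<And>n. closed (D n)" "\<And>n. continuous_on (D n) (f n)" "\<And>n. f n ` D n = A n"
    using assms unfolding analytic_def by metis
  define p where "p n z = (\<lambda>m. z (prod_encode (n, m)))" for n and z :: "nat \<Rightarrow> real"
  have p: "(\<lambda>k. p n (z k)) \<longlonglongrightarrow> p n l" if "z \<longlonglongrightarrow> l" for z l n
    unfolding p_def by (rule tendsto_reindex[OF that])
  define D' where "D' = {z. \<forall>n. p n z \<in> D n \<and> f n (p n z) = f 0 (p 0 z)}"
  have "closed D'"
    unfolding closed_sequential_limits
  proof (intro allI impI)
    fix z l assume zl: "(\<forall>k. z k \<in> D') \<and> z \<longlonglongrightarrow> l"
    have D: "p n l \<in> D n" for n
      by (rule closed_sequentially[OF Df(1) _ p]) (use zl in \<open>auto simp: D'_def\<close>)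
    have f: "(\<lambda>k. f n (p n (z k))) \<longlonglongrightarrow> f n (p n l)" for n
      by (rule continuous_on_tendsto_compose[OF Df(2) p]) (use zl D in \<open>auto simp: D'_def\<close>)
    have "f n (p n l) = f 0 (p 0 l)" for n
    proof (rule LIMSEQ_unique[OF f])
      have "f n (p n (z k)) = f 0 (p 0 (z k))" for k using zl unfolding D'_def by blast
      then show "(\<lambda>k. f n (p n (z k))) \<longlonglongrightarrow> f 0 (p 0 l)" using f[of 0] by presburger
    qed
    then show "l \<in> D'" using D by (simp add: D'_def)
  qed
  moreover have "continuous_on D' (\<lambda>z. f 0 (p 0 z))"
    by (rule continuous_on_compose2[OF Df(2)])
       (auto simp: p_def D'_def intro!: continuous_on_reindex)
  moreover have "(\<lambda>z. f 0 (p 0 z)) ` D' = (\<Inter>n. A n)"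
  proof (intro equalityI subsetI)
    fix y assume "y \<in> (\<lambda>z. f 0 (p 0 z)) ` D'"
    then obtain z where z: "z \<in> D'" "y = f 0 (p 0 z)" by blast
    then have "f n (p n z) = y" "p n z \<in> D n" for n by (simp_all add: D'_def)
    then have "y \<in> A n" for n using Df(3)[of n] by (metis imageI)
    then show "y \<in> (\<Inter>n. A n)" by blast
  next
    fix y assume "y \<in> (\<Inter>n. A n)"
    then have "\<exists>w. w \<in> D n \<and> f n w = y" for n using Df(3)[of n] by (metis INT_E UNIV_I imageE)
    then obtain w where w: "\<And>n. w n \<in> D n" "\<And>n. f n (w n) = y" by metis
    define z where "z i = (case prod_decode i of (n, m) \<Rightarrow> w n m)" for i
    have pz: "p n z = w n" for n by (simp add: p_def z_def)
    have "z \<in> D'" using w by (simp add: D'_def pz)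
    moreover have "y = f 0 (p 0 z)" using w by (simp add: pz)
    ultimately show "y \<in> (\<lambda>z. f 0 (p 0 z)) ` D'" by blast
  qed
  ultimately show ?thesis unfolding analytic_def by blast
qed

lemma analytic_Int:
  fixes A B :: "'b::t2_space set"
  assumes "analytic A" "analytic B"
  shows "analytic (A \<inter> B)"
proof -
  have "(\<Inter>n::nat. if n = 0 then A else B) = A \<inter> B" by (auto split: if_splits)
  then show ?thesis using analytic_INT[of "\<lambda>n. if n = 0 then A else B"] assms by auto
qed

lemma analytic_Un:
  fixes A B :: "'b::topological_space set"
  assumes "analytic A" "analytic B"
  shows "analytic (A \<union> B)"
proof -
  have "(\<Union>n::nat. if n = 0 then A else B) = A \<union> B" by (auto split: if_splits)
  then show ?thesis using analytic_UN[of "\<lambda>n. if n = 0 then A else B"] assms by auto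
qed

text \<open>Analyticity does not pass to complements, so the induction over the Borel sets carries
  \<open>A\<close> and \<open>- A\<close> together. Open sets enter as countable unions of closed
  ones.\<close>

lemma analytic_borel:
  fixes A :: "'b::metric_space set"
  assumes closed: "\<And>C :: 'b set. closed C \<Longrightarrow> analytic C"
  assumes A: "A \<in> sets borel"
  shows "analytic A"
proof -
  have "open": "analytic U" if U: "open U" for U :: "'b set"
  proof -
    have eq: "U = (\<Union>n. {x. \<forall>y. y \<notin> U \<longrightarrow> 1 / real (Suc n) \<le> dist x y})" (is "_ = (\<Union>n. ?C n)")
    proof (intro equalityI subsetI)
      fix x assume "x \<in> U"
      then obtain e where e: "e > 0" "ball x e \<subseteq> U" using U unfolding open_contains_ball by metis
      obtain n where "1 / real (Suc n) < e" using nat_approx_posE[OF e(1)] .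
      then have "1 / real (Suc n) \<le> dist x y" if "y \<notin> U" for y
        using e(2) that by (metis less_imp_le mem_ball not_le order.strict_trans1 subsetD)
      then have "x \<in> ?C n" by blast
      then show "x \<in> (\<Union>n. ?C n)" by blast
    next
      fix x assume "x \<in> (\<Union>n. ?C n)"
      then obtain n where "y \<notin> U \<Longrightarrow> 1 / real (Suc n) \<le> dist x y" for y by blast
      from this[of x] show "x \<in> U" by (auto simp: divide_le_0_iff)
    qed
    have "closed (?C n)" for n
      by (intro closed_Collect_all closed_Collect_imp open_Collect_const closed_Collect_le
            continuous_intros)
    then show ?thesis by (subst eq) (intro analytic_UN closed)
  qed
  have "A \<in> sigma_sets UNIV {U. open U}" using A by (simp add: borel_def)
  then have "analytic A \<and> analytic (- A)"
  proof induction
    case (Basic U)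
    then show ?case using "open" closed by (auto simp: closed_Compl)
  next
    case Empty
    then show ?case using "open" by simp
  next
    case (Compl a)
    then show ?case by (simp add: Compl_eq_Diff_UNIV[symmetric])
  next
    case (Union a)
    then show ?case using analytic_UN[of a] analytic_INT[of "\<lambda>n. - a n"] by auto
  qed
  then show ?thesis by blast
qed

section \<open>Separation of countable families of analytic sets\<close>

definition borel_separated :: "(nat \<Rightarrow> 'b::topological_space set) \<Rightarrow> bool" where
  "borel_separated A \<longleftrightarrow>
     (\<exists>B. (\<forall>n. B n \<in> sets borel \<and> A n \<subseteq> B n) \<and> (\<Inter>n. B n) = {})"

text \<open>Hulls for the pieces combine: a union at \<open>m\<close>, intersections elsewhere. Used
  in contrapositive form, to find a piece of \<open>A m\<close> that keeps the family
  inseparable.\<close>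

lemma borel_separated_split:
  fixes A :: "nat \<Rightarrow> 'b::topological_space set" and C :: "nat \<Rightarrow> 'b set"
  assumes "A m \<subseteq> (\<Union>k. C k)" and "\<And>k. borel_separated (A(m := C k))"
  shows "borel_separated A"
proof -
  obtain B where B: "\<And>k n. B k n \<in> sets borel" "\<And>k n. (A(m := C k)) n \<subseteq> B k n"
      "\<And>k. (\<Inter>n. B k n) = {}"
    using assms(2) unfolding borel_separated_def by metis
  define B' where "B' n = (if n = m then \<Union>k. B k n else \<Inter>k. B k n)" for n
  have "B' n \<in> sets borel" for n
    unfolding B'_def using B(1) by auto
  moreover have "A n \<subseteq> B' n" for n
  proof (cases "n = m")
    case True
    then show ?thesis using assms(1) B(2)[of _ m] by (fastforce simp: B'_def)
  next
    case False
    then show ?thesis using B(2)[of _ n] by (auto simp: B'_def)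
  qed
  moreover have "(\<Inter>n. B' n) = {}"
  proof (rule equals0I)
    fix y assume y: "y \<in> (\<Inter>n. B' n)"
    then have "y \<in> B' m" by blast
    then obtain k where "y \<in> B k m" by (auto simp: B'_def)
    moreover have "y \<in> B k n" if "n \<noteq> m" for n using y that by (auto simp: B'_def dest: spec[of _ n])
    ultimately have "y \<in> B k n" for n by (cases "n = m") auto
    then have "y \<in> (\<Inter>n. B k n)" by blast
    then show False using B(3) by blast
  qed
  ultimately show ?thesis unfolding borel_separated_def by blast
qed

text \<open>
  Splitting one set at a time into countably many pieces of small parameter diameter preserves
  inseparability of some choice of pieces. In the limit the parameters converge to points with
  different images, whose disjoint neighbourhoods separate the pieces.
\<close>

theorem novikov_separation:
  fixes A :: "nat \<Rightarrow> 'b::t2_space set"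
  assumes analytic: "\<And>n. analytic (A n)" and disj: "(\<Inter>n. A n) = {}"
  shows "borel_separated A"
proof (rule ccontr)
  assume nsep: "\<not> borel_separated A"
  obtain D :: "nat \<Rightarrow> (nat \<Rightarrow> real) set" and f
    where Df: "\<And>n. closed (D n)" "\<And>n. continuous_on (D n) (f n)" "\<And>n. f n ` D n = A n"
    using analytic unfolding analytic_def by metis
  obtain q :: "nat \<Rightarrow> nat \<Rightarrow> real" where q: "\<And>U. open U \<Longrightarrow> U \<noteq> {} \<Longrightarrow> \<exists>i. q i \<in> U"
  proof -
    obtain Q :: "(nat \<Rightarrow> real) set" where "countable Q" "\<And>U. open U \<Longrightarrow> U \<noteq> {} \<Longrightarrow> \<exists>i\<in>Q. i \<in> U"
      using countable_dense_exists[where ?'a="nat \<Rightarrow> real"] by metis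
    moreover then have "Q \<noteq> {}" by (metis open_UNIV UNIV_not_empty empty_iff)
    ultimately show thesis using that[of "from_nat_into Q"]
      by (metis from_nat_into_surj)
  qed
  have step: "\<exists>V'. \<not> borel_separated (\<lambda>n. f n ` (D n \<inter> V' n)) \<and> (\<forall>n. closed (V' n)) \<and>
       (\<forall>n. V' n \<subseteq> V n) \<and> (\<exists>w. V' m \<subseteq> cball w (1 / real (Suc t)))"
    if ns: "\<not> borel_separated (\<lambda>n. f n ` (D n \<inter> V n))" and cl: "\<forall>n. closed (V n)" for V m t
  proof -
    let ?C = "\<lambda>k. cball (q k) (1 / real (Suc t))"
    have "(\<Union>k. ?C k) = UNIV"
    proof -
      have "\<exists>k. y \<in> ?C k" for y using q[of "ball y (1 / real (Suc t))"]
        by (auto simp: dist_commute intro: less_imp_le)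
      then show ?thesis by blast
    qed
    then have "f m ` (D m \<inter> V m) \<subseteq> (\<Union>k. f m ` (D m \<inter> (V m \<inter> ?C k)))" by fastforce
    then obtain k where
      k: "\<not> borel_separated ((\<lambda>n. f n ` (D n \<inter> V n))(m := f m ` (D m \<inter> (V m \<inter> ?C k))))"
      using borel_separated_split[of "\<lambda>n. f n ` (D n \<inter> V n)" m] ns by blast
    have "(\<lambda>n. f n ` (D n \<inter> V n))(m := f m ` (D m \<inter> (V m \<inter> ?C k))) =
        (\<lambda>n. f n ` (D n \<inter> (V(m := V m \<inter> ?C k)) n))" by (auto simp: fun_eq_iff simp del: of_nat_Suc)
    then show ?thesis using k cl
      by (intro exI[of _ "V(m := V m \<inter> ?C k)"]) auto
  qed
  let ?P = "\<lambda>t V. \<not> borel_separated (\<lambda>n. f n ` (D n \<inter> V n)) \<and> (\<forall>n. closed (V n))"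
  \<comment> \<open>Stage \<open>t\<close> shrinks only the set with index
    \<open>fst (prod_decode t)\<close>; every index recurs at infinitely many stages.\<close>
  let ?Q = "\<lambda>t V V'. (\<forall>n. V' n \<subseteq> V n) \<and> (\<exists>w. V' (fst (prod_decode t)) \<subseteq> cball w (1 / real (Suc t)))"
  have "\<exists>V. \<forall>t::nat. ?P t (V t) \<and> ?Q t (V t) (V (Suc t))"
  proof (rule dependent_nat_choice[where P = ?P and Q = ?Q])
    show "\<exists>V. ?P 0 V" using nsep Df(3) by (intro exI[of _ "\<lambda>_. UNIV"]) auto
    show "\<exists>V'. ?P (Suc t) V' \<and> ?Q t V V'" if "?P t V" for V t
      using step[of V "fst (prod_decode t)" t] that by blast
  qed
  then obtain V where V1: "\<And>t. \<not> borel_separated (\<lambda>n. f n ` (D n \<inter> V t n))"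
    and V2: "\<And>t n. closed (V t n)" and V3: "\<And>t n. V (Suc t) n \<subseteq> V t n"
    and V4: "\<And>t. \<exists>w. V (Suc t) (fst (prod_decode t)) \<subseteq> cball w (1 / real (Suc t))" by blast
  have small: "\<exists>t. \<forall>x\<in>V t n. \<forall>y\<in>V t n. dist x y < e" if e: "e > 0" for n e
  proof -
    obtain j where j: "1 / real (Suc j) < e / 2" using nat_approx_posE[OF half_gt_zero[OF e]] .
    \<comment> \<open>The stage coding \<open>(n, j)\<close> treats index \<open>n\<close>, and its
      number is at least \<open>j\<close>, so its radius is small enough.\<close>
    define t where "t = prod_encode (n, j)"
    obtain w where "V (Suc t) n \<subseteq> cball w (1 / real (Suc t))" using V4[of t] by (auto simp: t_def)
    moreover have "1 / real (Suc t) \<le> 1 / real (Suc j)"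
      using le_prod_encode_2[of j n] by (simp add: t_def frac_le)
    ultimately have w: "V (Suc t) n \<subseteq> ball w (e / 2)" using j by force
    have "dist x y < e" if "x \<in> V (Suc t) n" "y \<in> V (Suc t) n" for x y
      using subsetD[OF w that(1)] subsetD[OF w that(2)] by (metis dist_commute dist_triangle_half_r mem_ball)
    then show ?thesis by blast
  qed
  have ne: "D n \<inter> V t n \<noteq> {}" for n t
  proof
    assume e: "D n \<inter> V t n = {}"
    have "borel_separated (\<lambda>n. f n ` (D n \<inter> V t n))"
      unfolding borel_separated_def
      by (rule exI[of _ "\<lambda>i. if i = n then {} else UNIV"]) (use e in \<open>auto split: if_splits\<close>)
    then show False using V1 by blast
  qed
  have "\<exists>z. (\<Inter>t. D n \<inter> V t n) = {z}" for n
  proof (rule decreasing_closed_nest_sing)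
    show "closed (D n \<inter> V t n)" for t using Df(1) V2 by blast
    show "D n \<inter> V t n \<noteq> {}" for t by (rule ne)
    show "D n \<inter> V t n \<subseteq> D n \<inter> V s n" if "s \<le> t" for s t
      using lift_Suc_antimono_le[of "\<lambda>t. V t n", OF V3 that] by blast
    show "\<exists>t. \<forall>x\<in>D n \<inter> V t n. \<forall>y\<in>D n \<inter> V t n. dist x y < e" if "e > 0" for e
      using small[OF that, of n] by (meson IntD2)
  qed
  then obtain z where z: "\<And>n. (\<Inter>t. D n \<inter> V t n) = {z n}" by metis
  then have zD: "z n \<in> D n" and zV: "z n \<in> V t n" for n t by blast+
  have loc: "\<exists>t. \<forall>s\<ge>t. f n ` (D n \<inter> V s n) \<subseteq> U" if U: "open U" "f n (z n) \<in> U" for n U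
  proof -
    obtain e where e: "e > 0" "\<And>x. x \<in> D n \<Longrightarrow> dist x (z n) < e \<Longrightarrow> f n x \<in> U"
    proof -
      obtain O' where "open O'" "z n \<in> O'" "\<And>x. x \<in> D n \<Longrightarrow> x \<in> O' \<Longrightarrow> f n x \<in> U"
        using Df(2)[of n] zD U unfolding continuous_on_topological by metis
      moreover then obtain e where "e > 0" "ball (z n) e \<subseteq> O'" unfolding open_contains_ball by metis
      moreover have "x \<in> ball (z n) e" if "dist x (z n) < e" for x
        using that by (simp add: dist_commute)
      ultimately show thesis by (intro that[of e]) blast+
    qed
    obtain t where t: "\<forall>x\<in>V t n. \<forall>y\<in>V t n. dist x y < e" using small e(1) by blast
    have "f n x \<in> U" if "s \<ge> t" "x \<in> D n" "x \<in> V s n" for s x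
      using t e(2) that zV lift_Suc_antimono_le[of "\<lambda>t. V t n", OF V3 that(1)] by blast
    then show ?thesis by blast
  qed
  obtain m where m: "f m (z m) \<noteq> f 0 (z 0)"
  proof -
    have "\<exists>m. f m (z m) \<noteq> f 0 (z 0)"
    proof (rule ccontr)
      assume "\<not> (\<exists>m. f m (z m) \<noteq> f 0 (z 0))"
      moreover have "f m (z m) \<in> A m" for m using zD Df(3) by blast
      ultimately have "f 0 (z 0) \<in> (\<Inter>n. A n)" by (metis INT_I)
      then show False using disj by blast
    qed
    then show thesis using that by blast
  qed
  obtain U U' where U: "open U" "open U'" "f m (z m) \<in> U" "f 0 (z 0) \<in> U'" "U \<inter> U' = {}"
    using hausdorff[OF m] by blast
  obtain t t' where t: "\<forall>s\<ge>t. f m ` (D m \<inter> V s m) \<subseteq> U" "\<forall>s\<ge>t'. f 0 ` (D 0 \<inter> V s 0) \<subseteq> U'"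
    using loc U by meson
  have "m \<noteq> 0" using m by metis
  have "borel_separated (\<lambda>n. f n ` (D n \<inter> V (max t t') n))"
    unfolding borel_separated_def
  proof (intro exI[of _ "\<lambda>i. if i = m then U else if i = 0 then U' else UNIV"] conjI allI)
    show "(\<Inter>i. if i = m then U else if i = 0 then U' else UNIV) = {}"
    proof (rule equals0I)
      fix y assume "y \<in> (\<Inter>i. if i = m then U else if i = 0 then U' else UNIV)"
      then have "\<And>i. y \<in> (if i = m then U else if i = 0 then U' else UNIV)" by blast
      from this[of m] this[of 0] show False using U(5) \<open>m \<noteq> 0\<close> by auto
    qed
  qed (use t U in auto)
  then show False using V1 by blast
qed

corollary lusin_separation:
  fixes A B :: "'b::t2_space set"
  assumes "analytic A" "analytic B" "A \<inter> B = {}"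
  obtains C where "C \<in> sets borel" "A \<subseteq> C" "C \<inter> B = {}"
proof -
  let ?A = "\<lambda>n::nat. if n = 0 then A else B"
  have "(\<Inter>n. ?A n) = {}" using assms(3) by (auto split: if_splits)
  then have "borel_separated ?A" using assms by (intro novikov_separation) auto
  then obtain C where C: "\<And>n. C n \<in> sets borel" "\<And>n. ?A n \<subseteq> C n" "(\<Inter>n. C n) = {}"
    unfolding borel_separated_def by blast
  have "A \<subseteq> C 0" using C(2)[of 0] by simp
  moreover have "C 0 \<inter> B = {}"
  proof (rule equals0I)
    fix y assume y: "y \<in> C 0 \<inter> B"
    then have "y \<in> C n" for n using C(2)[of n] by (cases "n = 0") auto
    then show False using C(3) by blast
  qed
  ultimately show thesis using that C(1) by blast
qed

section \<open>Projections of Borel sets with finite sections\<close>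

text \<open>Provides the cylinders over projections in the next theorem. Even coordinates carry the
  parameters of \<open>A\<close>, odd ones the free second factor.\<close>

lemma analytic_Times_UNIV:
  assumes "analytic (A :: (nat \<Rightarrow> real) set)"
  shows "analytic (A \<times> (UNIV :: (nat \<Rightarrow> real) set))"
proof -
  obtain D :: "(nat \<Rightarrow> real) set" and f where Df: "closed D" "continuous_on D f" "f ` D = A"
    using assms unfolding analytic_def by blast
  define ev od :: "(nat \<Rightarrow> real) \<Rightarrow> nat \<Rightarrow> real"
    where "ev z = (\<lambda>m. z (2 * m))" and "od z = (\<lambda>m. z (2 * m + 1))" for z
  have c: "continuous_on S ev" "continuous_on S od" for S
    unfolding ev_def od_def by (intro continuous_intros)+
  define g where "g z = (f (ev z), od z)" for z
  have "closed (ev -` D)" using Df(1) c by (intro closed_vimage) auto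
  moreover have "continuous_on (ev -` D) g"
    unfolding g_def by (intro continuous_on_Pair c continuous_on_compose2[OF Df(2)]) auto
  moreover have "g ` (ev -` D) = A \<times> UNIV"
  proof (intro equalityI subsetI)
    fix p assume "p \<in> A \<times> (UNIV :: (nat \<Rightarrow> real) set)"
    then obtain w b where p: "p = (f w, b)" "w \<in> D" using Df(3) by auto
    define z where "z i = (if even i then w (i div 2) else b (i div 2))" for i :: nat
    have "ev z = w" "od z = b" by (auto simp: ev_def od_def z_def)
    then show "p \<in> g ` (ev -` D)" using p by (intro image_eqI[of _ _ z]) (auto simp: g_def)
  qed (use Df(3) in \<open>auto simp: g_def\<close>)
  ultimately show ?thesis unfolding analytic_def by blast
qed

lemma analytic_borel_seq:
  "A \<in> sets borel \<Longrightarrow> analytic (A :: (nat \<Rightarrow> real) set)"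
  "B \<in> sets borel \<Longrightarrow> analytic (B :: ((nat \<Rightarrow> real) \<times> (nat \<Rightarrow> real)) set)"
  by (auto intro: analytic_borel analytic_closed analytic_closed_prod)

lemma analytic_fst_image:
  "P \<in> sets borel \<Longrightarrow> analytic (fst ` (P :: ((nat \<Rightarrow> real) \<times> (nat \<Rightarrow> real)) set))"
  by (intro analytic_image analytic_borel_seq continuous_on_fst continuous_on_id)

text \<open>
  Following Kunugui and Novikov, the complement of \<open>P\<close> is a union of countably many Borel
  rectangles with open second factor; by compactness an empty section is covered by finitely
  many of these factors.
\<close>

theorem borel_fst_image_compact:
  fixes P :: "((nat \<Rightarrow> real) \<times> (nat \<Rightarrow> real)) set"
  assumes P: "P \<in> sets borel" and K: "compact K" "P \<subseteq> UNIV \<times> K"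
    and closed: "\<And>x. closed {y. (x, y) \<in> P}"
  shows "fst ` P \<in> sets borel"
proof -
  obtain \<B> :: "(nat \<Rightarrow> real) set set" where \<B>: "countable \<B>" "topological_basis \<B>"
    using ex_countable_basis by blast
  define U where "U = from_nat_into \<B>"
  have "\<B> \<noteq> {}"
    using topological_basisE[OF \<B>(2) open_UNIV UNIV_I] by blast
  then have rU: "range U = \<B>" using \<B>(1) by (simp add: U_def)
  then have oU: "open (U n)" for n using \<B>(2) topological_basis_open by blast
  have basis: "\<exists>n. y \<in> U n \<and> U n \<subseteq> V" if "open V" "y \<in> V" for y V
    using topological_basisE[OF \<B>(2) that] rU by (metis rangeE)
  define X where "X n = fst ` (P \<inter> UNIV \<times> U n)" for n
  have aX: "analytic (X n)" for n
    unfolding X_def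
    by (intro analytic_fst_image sets.Int[OF P borel_open[OF open_Times[OF open_UNIV oU]]])
  \<comment> \<open>The part of \<open>- P\<close> outside the rectangle
    \<open>(- X n) \<times> U n\<close>. These rectangles avoid \<open>P\<close> and, the sections
    being closed, cover \<open>- P\<close>; but their bases are only known to be coanalytic, and
    separation has to supply Borel ones.\<close>
  define Z where "Z n = - P \<inter> (UNIV \<times> (- U n) \<union> X n \<times> UNIV)" for n
  have "analytic (Z n)" for n
    unfolding Z_def
    by (intro analytic_Int analytic_Un analytic_Times_UNIV[OF aX] analytic_borel_seq(2)[OF borel_comp[OF P]]
          analytic_closed_prod closed_Times closed_UNIV closed_Compl oU)
  moreover have "(\<Inter>n. Z n) = {}"
  proof (rule equals0I)
    fix p assume p: "p \<in> (\<Inter>n. Z n)"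
    obtain x y where xy: "p = (x, y)" by fastforce
    have "open (- {y. (x, y) \<in> P})" using closed by blast
    moreover have "y \<in> - {y. (x, y) \<in> P}" using p by (auto simp: xy Z_def)
    ultimately obtain n where "y \<in> U n" "U n \<subseteq> - {y. (x, y) \<in> P}" using basis by blast
    then have "p \<notin> Z n" by (auto simp: xy Z_def X_def)
    then show False using p by blast
  qed
  ultimately have "borel_separated Z" by (rule novikov_separation)
  then obtain C where C: "\<And>n. C n \<in> sets borel" "\<And>n. Z n \<subseteq> C n" "(\<Inter>n. C n) = {}"
    unfolding borel_separated_def by blast
  \<comment> \<open>A Borel part of \<open>- P\<close> inside the n-th rectangle; these parts still
    cover \<open>- P\<close>. The projection of \<open>G n\<close> is analytic and misses
    \<open>X n\<close>, so a Borel \<open>A n\<close> fits between it and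
    \<open>- X n\<close>.\<close>
  define G where "G n = - P - C n" for n
  have "\<exists>A. A \<in> sets borel \<and> fst ` G n \<subseteq> A \<and> A \<inter> X n = {}" for n
  proof -
    have "analytic (fst ` G n)"
      unfolding G_def by (intro analytic_fst_image sets.Diff[OF borel_comp[OF P] C(1)])
    moreover have "fst ` G n \<inter> X n = {}"
      using C(2)[of n] by (auto simp: G_def Z_def)
    ultimately show ?thesis using lusin_separation[OF _ aX[of n]] by metis
  qed
  then obtain A where A: "\<And>n. A n \<in> sets borel" "\<And>n. fst ` G n \<subseteq> A n" "\<And>n. A n \<inter> X n = {}"
    by metis
  \<comment> \<open>Finite covers by basic open sets form a countable family. The double complement
    below is the intersection of the \<open>A j\<close>.\<close>
  define \<J> where "\<J> = {J. finite J \<and> K \<subseteq> (\<Union>j\<in>J. U j)}"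
  have "- (fst ` P) = (\<Union>J\<in>\<J>. - (\<Union>j\<in>J. - A j))"
  proof (intro equalityI subsetI)
    fix x assume x: "x \<in> - (fst ` P)"
    have "K \<subseteq> (\<Union>n\<in>{n. x \<in> A n}. U n)"
    proof
      fix y assume "y \<in> K"
      have xy: "(x, y) \<notin> P" using x by force
      obtain n where "(x, y) \<notin> C n" using C(3) by blast
      then have "(x, y) \<in> G n" "(x, y) \<notin> Z n" using xy C(2) by (auto simp: G_def)
      then have "x \<in> A n" "y \<in> U n" using A(2)[of n] xy by (force simp: Z_def)+
      then show "y \<in> (\<Union>n\<in>{n. x \<in> A n}. U n)" by blast
    qed
    then obtain J where "J \<subseteq> {n. x \<in> A n}" "finite J" "K \<subseteq> (\<Union>n\<in>J. U n)"
      using compactE_image[OF K(1), of "{n. x \<in> A n}" U] oU by blast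
    then show "x \<in> (\<Union>J\<in>\<J>. - (\<Union>j\<in>J. - A j))" by (auto simp: \<J>_def)
  next
    fix x assume "x \<in> (\<Union>J\<in>\<J>. - (\<Union>j\<in>J. - A j))"
    then obtain J where J: "K \<subseteq> (\<Union>j\<in>J. U j)" "\<And>j. j \<in> J \<Longrightarrow> x \<in> A j"
      by (auto simp: \<J>_def)
    show "x \<in> - (fst ` P)"
    proof
      assume "x \<in> fst ` P"
      then obtain y where xy: "(x, y) \<in> P" by auto
      then have "y \<in> K" using K(2) by blast
      then obtain j where j: "j \<in> J" "y \<in> U j" using J(1) by blast
      then have "x \<in> X j" using xy by (force simp: X_def)
      then show False using J(2)[OF j(1)] A(3)[of j] by blast
    qed
  qed
  moreover have "- (\<Union>j\<in>J. - A j) \<in> sets borel" for J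
    by (intro borel_comp sets.countable_UN') (auto intro: borel_comp[OF A(1)])
  moreover have "countable \<J>"
    using countable_Collect_finite[where ?'a = nat] by (rule countable_subset[rotated]) (auto simp: \<J>_def)
  ultimately have "- (fst ` P) \<in> sets borel" by (simp only: sets.countable_UN'')
  then show ?thesis using borel_comp by (metis double_compl)
qed

section \<open>Borel isomorphisms onto Borel sets of real sequences\<close>

definition borel_embedding :: "'a measure \<Rightarrow> ('a \<Rightarrow> nat \<Rightarrow> real) \<Rightarrow> bool" where
  "borel_embedding N e \<longleftrightarrow>
     inj_on e (space N) \<and> e \<in> N \<rightarrow>\<^sub>M borel \<and> (\<forall>A\<in>sets N. e ` A \<in> sets borel)"

text \<open>Injectivity makes images commute with relative complements, so the generators and the
  whole space decide.\<close>

lemma image_sigma_sets: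
  assumes inj: "inj_on f \<Omega>" and G: "G \<subseteq> Pow \<Omega>" and L: "\<And>A. A \<in> G \<Longrightarrow> f ` A \<in> sets L" "f ` \<Omega> \<in> sets L"
    and A: "A \<in> sigma_sets \<Omega> G"
  shows "f ` A \<in> sets L"
  using A
proof induction
  case (Compl A)
  have "f ` (\<Omega> - A) = f ` \<Omega> - f ` A"
    using Compl.hyps sigma_sets_into_sp[OF G] inj by (meson inj_on_image_set_diff order_refl Diff_subset)
  then show ?case using Compl L(2) by auto
next
  case (Union A)
  then show ?case by (auto simp: image_UN)
qed (use L in auto)

lemma map_prod_image_sets:
  assumes e: "borel_embedding N e" and f: "borel_embedding M f" and P: "P \<in> sets (N \<Otimes>\<^sub>M M)"
  shows "map_prod e f ` P \<in> sets borel"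
proof (rule image_sigma_sets[where \<Omega> = "space N \<times> space M"])
  show "P \<in> sigma_sets (space N \<times> space M) {a \<times> b | a b. a \<in> sets N \<and> b \<in> sets M}"
    using P by (simp add: sets_pair_measure)
  show "inj_on (map_prod e f) (space N \<times> space M)"
    using e f by (auto simp: borel_embedding_def intro: map_prod_inj_on)
  have *: "map_prod e f ` (a \<times> b) \<in> sets borel" if "a \<in> sets N" "b \<in> sets M" for a b
  proof -
    have "map_prod e f ` (a \<times> b) = e ` a \<times> f ` b" by auto
    then show ?thesis using that e f by (simp add: borel_embedding_def borel_Times)
  qed
  show "map_prod e f ` (space N \<times> space M) \<in> sets borel" by (rule *) auto
  show "map_prod e f ` A \<in> sets borel" if "A \<in> {a \<times> b | a b. a \<in> sets N \<and> b \<in> sets M}" for A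
    using * that by blast
qed (auto dest!: sets.sets_into_space)

lemma compact_unit_cube: "compact {z :: 'i \<Rightarrow> real. \<forall>i. 0 \<le> z i \<and> z i \<le> 1}"
proof -
  have "compactin (product_topology (\<lambda>_. euclidean) UNIV) (PiE UNIV (\<lambda>_ :: 'i. {0..1::real}))"
    by (auto simp: compactin_PiE)
  moreover have "PiE UNIV (\<lambda>_ :: 'i. {0..1::real}) = {z. \<forall>i. 0 \<le> z i \<and> z i \<le> 1}"
    by (auto simp: PiE_UNIV_domain)
  ultimately show ?thesis by (simp add: euclidean_product_topology)
qed

text \<open>The image consists of those \<open>b\<close> that behave like the distances to the dense points
  \<open>q n\<close>; completeness supplies the point they belong to.\<close>

lemma standard_borel_embedding:
  assumes "standard_borel M"
  shows "\<exists>e. borel_embedding M e \<and> e ` space M \<subseteq> {z. \<forall>i. 0 \<le> z i \<and> z i \<le> 1}"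
proof (cases "space M = {}")
  case True
  then have "A = {}" if "A \<in> sets M" for A using sets.sets_into_space[OF that] by simp
  then have "\<forall>A\<in>sets M. (\<lambda>_ _. 0 :: real) ` A \<in> sets (borel :: (nat \<Rightarrow> real) measure)" by fastforce
  then have "borel_embedding M (\<lambda>_ _. 0)"
    using True by (simp add: borel_embedding_def)
  then show ?thesis by (intro exI[of _ "\<lambda>_ _. 0"]) (simp add: True)
next
  case False
  obtain T where T: "completely_metrizable_space T" "separable_space T" "topspace T = space M"
      "sets M = sigma_sets (space M) {U. openin T U}"
    using assms unfolding standard_borel_def polish_topology_def by blast
  obtain X0 d0 where d0: "Metric_space X0 d0" "Metric_space.mcomplete X0 d0"
      "T = Metric_space.mtopology X0 d0"
    using T(1) unfolding completely_metrizable_space_def by blast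
  have X0: "X0 = space M" using T(3) d0(1,3) Metric_space.topspace_mtopology by blast
  \<comment> \<open>Capping the metric at 1 keeps topology and completeness and puts the distances
    into the unit cube.\<close>
  define d where "d = Metric_space.capped_dist d0 1"
  interpret Metric_space "space M" d
    using Metric_space.capped_dist[OF d0(1)] by (simp add: X0 d_def)
  have topT: "T = mtopology" and complete: "mcomplete"
    using Metric_space.mtopology_capped_metric[OF d0(1), of 1]
      Metric_space.mcomplete_capped_metric[OF d0(1), of 1] d0 by (simp_all add: X0 d_def)
  have d1: "d x y \<le> 1" for x y
    using d0(1) by (simp add: d_def Metric_space.capped_dist_def)
  obtain Q where Q: "countable Q" "Q \<subseteq> space M" "T closure_of Q = space M"
    using T(2,3) unfolding separable_space_def by auto
  have "Q \<noteq> {}" using Q(3) False by auto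
  define q where "q = from_nat_into Q"
  have rq: "range q = Q" using Q(1) \<open>Q \<noteq> {}\<close> by (simp add: q_def)
  have qM: "q n \<in> space M" for n using rq Q(2) by blast
  have dense: "\<exists>n. d x (q n) < r" if "x \<in> space M" "r > 0" for x r
  proof -
    have "x \<in> mtopology closure_of Q" using that Q(3) topT by simp
    then have "\<exists>y\<in>Q. y \<in> mball x r" using that unfolding metric_closure_of by blast
    then show ?thesis using rq by (auto simp: image_iff)
  qed
  define e where "e x = (\<lambda>n. d x (q n))" for x
  have inj: "inj_on e (space M)"
  proof (rule inj_onI)
    fix x y assume xy: "x \<in> space M" "y \<in> space M" "e x = e y"
    have "d x y \<le> 2 * r" if "r > 0" for r
    proof -
      obtain n where n: "d x (q n) < r" using dense xy(1) \<open>r > 0\<close> by blast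
      have "d y (q n) = d x (q n)" using xy(3) by (metis e_def)
      then show ?thesis using triangle[OF xy(1) qM[of n] xy(2)] n commute[of y "q n"] by linarith
    qed
    from this[of "d x y / 3"] have "\<not> d x y > 0" by auto
    then show "x = y" using xy zero nonneg[of x y] by (metis less_eq_real_def)
  qed
  have "openin": "mball x r \<in> sets M" for x r
    using openin_mball[of x r] T(4) topT by auto
  have em: "e \<in> M \<rightarrow>\<^sub>M borel"
  proof (rule measurable_coordinatewise_then_product)
    fix n
    show "(\<lambda>x. e x n) \<in> M \<rightarrow>\<^sub>M borel"
      unfolding borel_measurable_iff_less
    proof
      fix a
      have "{w \<in> space M. e w n < a} = mball (q n) a"
        using qM commute by (auto simp: e_def)
      then show "{w \<in> space M. e w n < a} \<in> sets M" using "openin" by simp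
    qed
  qed
  \<comment> \<open>The inequalities make \<open>b\<close> a Katetov function on the dense points:
    the distances to a point added to that space. The last condition places this point in their
    closure. All quantifiers are countable, so the set is Borel.\<close>
  define Im where "Im = {b :: nat \<Rightarrow> real. (\<forall>n m. \<bar>b n - b m\<bar> \<le> d (q n) (q m) \<and> d (q n) (q m) \<le> b n + b m)
      \<and> (\<forall>j. \<exists>n. b n < 1 / real (Suc j))}"
  have eM: "e ` space M = Im"
  proof (intro equalityI subsetI)
    fix b assume "b \<in> e ` space M"
    then obtain x where x: "x \<in> space M" "b = e x" by blast
    have "\<bar>d x (q n) - d x (q m)\<bar> \<le> d (q n) (q m) \<and> d (q n) (q m) \<le> d x (q n) + d x (q m)" for n m
      using triangle[OF x(1) qM[of n] qM[of m]] triangle[OF x(1) qM[of m] qM[of n]]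
        triangle[OF qM[of n] x(1) qM[of m]] commute[of x "q n"] commute[of "q m" "q n"] by linarith
    moreover have "\<exists>n. d x (q n) < 1 / real (Suc j)" for j by (rule dense[OF x(1)]) simp
    ultimately show "b \<in> Im" by (simp add: Im_def x e_def del: of_nat_Suc)
  next
    fix b assume b: "b \<in> Im"
    then have b1: "\<bar>b n - b m\<bar> \<le> d (q n) (q m)" "d (q n) (q m) \<le> b n + b m" for n m
      by (auto simp: Im_def)
    have "\<forall>j. \<exists>n. b n < 1 / real (Suc j)" using b by (simp add: Im_def del: of_nat_Suc)
    then obtain s where s: "\<And>j. b (s j) < 1 / real (Suc j)" by metis
    have b0: "b n \<ge> 0" for n using b1(2)[of n n] qM[of n] by simp
    have lim0: "(\<lambda>j. b (s j)) \<longlonglongrightarrow> 0"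
      by (rule tendsto_sandwich[OF _ _ tendsto_const LIMSEQ_inverse_real_of_nat])
         (use b0 s in \<open>auto simp: inverse_eq_divide intro!: always_eventually less_imp_le simp del: of_nat_Suc\<close>)
    have "MCauchy (\<lambda>j. q (s j))"
      unfolding MCauchy_def
    proof (intro conjI allI impI)
      show "range (\<lambda>j. q (s j)) \<subseteq> space M" using qM by blast
      fix \<epsilon> :: real assume "\<epsilon> > 0"
      then have "\<forall>\<^sub>F j in sequentially. b (s j) < \<epsilon> / 2" using order_tendstoD(2)[OF lim0, of "\<epsilon> / 2"] by simp
      then obtain N where N: "\<And>j. j \<ge> N \<Longrightarrow> b (s j) < \<epsilon> / 2" unfolding eventually_sequentially by blast
      show "\<exists>N. \<forall>n n'. N \<le> n \<longrightarrow> N \<le> n' \<longrightarrow> d (q (s n)) (q (s n')) < \<epsilon>"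
      proof (intro exI[of _ N] allI impI)
        fix n n' assume "N \<le> n" "N \<le> n'"
        then show "d (q (s n)) (q (s n')) < \<epsilon>"
          using N[of n] N[of n'] b1(2)[of "s n" "s n'"] by linarith
      qed
    qed
    then obtain x where x: "limitin mtopology (\<lambda>j. q (s j)) x sequentially"
      using complete unfolding mcomplete_def by blast
    then have xM: "x \<in> space M" using limitin_mspace by blast
    have dlim: "(\<lambda>j. d (q (s j)) x) \<longlonglongrightarrow> 0"
      using x by (simp add: limitin_metric_dist_null)
    have "d x (q n) = b n" for n
    proof (rule LIMSEQ_unique)
      have "(\<lambda>j. d (q (s j)) (q n) - d x (q n)) \<longlonglongrightarrow> 0"
      proof (rule Lim_null_comparison[OF _ dlim])
        show "\<forall>\<^sub>F j in sequentially. norm (d (q (s j)) (q n) - d x (q n)) \<le> d (q (s j)) x"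
        proof (rule always_eventually, rule allI)
          fix j
          show "norm (d (q (s j)) (q n) - d x (q n)) \<le> d (q (s j)) x"
            using triangle[OF qM[of "s j"] xM qM[of n]] triangle[OF xM qM[of "s j"] qM[of n]]
              commute[of x "q (s j)"] by simp
        qed
      qed
      then show "(\<lambda>j. d (q (s j)) (q n)) \<longlonglongrightarrow> d x (q n)" by (simp add: LIM_zero_iff)
      have "(\<lambda>j. d (q (s j)) (q n) - b n) \<longlonglongrightarrow> 0"
      proof (rule Lim_null_comparison[OF _ lim0])
        show "\<forall>\<^sub>F j in sequentially. norm (d (q (s j)) (q n) - b n) \<le> b (s j)"
        proof (rule always_eventually, rule allI)
          fix j
          show "norm (d (q (s j)) (q n) - b n) \<le> b (s j)"
            using b1[of "s j" n] by simp
        qed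
      qed
      then show "(\<lambda>j. d (q (s j)) (q n)) \<longlonglongrightarrow> b n" by (simp add: LIM_zero_iff)
    qed
    then have "e x = b" by (simp add: e_def fun_eq_iff)
    then show "b \<in> e ` space M" using xM by blast
  qed
  have coord [measurable]: "(\<lambda>b :: nat \<Rightarrow> real. b n) \<in> borel_measurable borel" for n
    by (intro borel_measurable_continuous_onI continuous_on_product_coordinates)
  have "Im \<in> sets borel"
  proof -
    have "{b \<in> space borel. (\<forall>n m. \<bar>b n - b m\<bar> \<le> d (q n) (q m) \<and> d (q n) (q m) \<le> b n + b m)
        \<and> (\<forall>j. \<exists>n. b n < 1 / real (Suc j))} \<in> sets (borel :: (nat \<Rightarrow> real) measure)"
      by measurable
    then show ?thesis by (simp add: Im_def)
  qed
  have eU: "e ` U \<in> sets borel" if U: "openin T U" for U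
  proof -
    \<comment> \<open>An open set is a union of balls around dense points, and the image of such a
      ball is cut out of \<open>Im\<close> by a condition on one coordinate.\<close>
    define I where "I = {(n, m). mball (q n) (1 / real (Suc m)) \<subseteq> U}"
    have "e ` U = Im \<inter> (\<Union>(n, m)\<in>I. {b \<in> space borel. b n < 1 / real (Suc m)})"
    proof (intro equalityI subsetI)
      fix b assume "b \<in> e ` U"
      then obtain x where x: "x \<in> U" "b = e x" by blast
      then have xM: "x \<in> space M" using U openin_subset T(3) by blast
      obtain r where r: "r > 0" "mball x r \<subseteq> U" using U x unfolding topT openin_mtopology by blast
      obtain m where m: "1 / real (Suc m) < r / 2" using nat_approx_posE[OF half_gt_zero[OF r(1)]] .
      obtain n where n: "d x (q n) < 1 / real (Suc m)" using dense[OF xM, of "1 / real (Suc m)"] by auto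
      have "mball (q n) (1 / real (Suc m)) \<subseteq> U"
      proof
        fix y assume "y \<in> mball (q n) (1 / real (Suc m))"
        then have y: "y \<in> space M" "d (q n) y < 1 / real (Suc m)" by auto
        then have "d x y < r" using triangle[OF xM qM[of n] y(1)] m n by linarith
        then show "y \<in> U" using r(2) xM y by auto
      qed
      then have "(n, m) \<in> I" by (simp add: I_def del: of_nat_Suc)
      then show "b \<in> Im \<inter> (\<Union>(n, m)\<in>I. {b \<in> space borel. b n < 1 / real (Suc m)})"
        using eM x xM n by (auto simp: e_def simp del: of_nat_Suc)
    next
      fix b assume b: "b \<in> Im \<inter> (\<Union>(n, m)\<in>I. {b \<in> space borel. b n < 1 / real (Suc m)})"
      then obtain x where x: "x \<in> space M" "b = e x" using eM by blast
      obtain n m where nm: "(n, m) \<in> I" "b n < 1 / real (Suc m)" using b by auto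
      then have "x \<in> mball (q n) (1 / real (Suc m))"
        using x qM commute by (simp add: e_def del: of_nat_Suc)
      then show "b \<in> e ` U" using nm x by (auto simp: I_def)
    qed
    moreover have "(\<Union>(n, m)\<in>I. {b \<in> space borel. b n < 1 / real (Suc m)}) \<in> sets borel"
      by (intro sets.countable_UN') (auto simp del: of_nat_Suc)
    ultimately show ?thesis using \<open>Im \<in> sets borel\<close> by simp
  qed
  have "e ` A \<in> sets borel" if "A \<in> sets M" for A
  proof (rule image_sigma_sets[OF inj])
    show "A \<in> sigma_sets (space M) {U. openin T U}" using that T(4) by simp
    show "e ` space M \<in> sets borel" using eM \<open>Im \<in> sets borel\<close> by simp
    show "{U. openin T U} \<subseteq> Pow (space M)" using openin_subset T(3) by blast
  qed (use eU in blast)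
  then have "borel_embedding M e" using inj em by (simp add: borel_embedding_def)
  moreover have "e ` space M \<subseteq> {z. \<forall>i. 0 \<le> z i \<and> z i \<le> 1}" using d1 by (auto simp: e_def)
  ultimately show ?thesis by blast
qed

text \<open>Borel embeddings carry \<open>P\<close> to a Borel set of pairs of sequences with second
  coordinates in the compact cube. Its sections are finite, hence closed, and the projection is
  pulled back along \<open>e\<close>.\<close>

theorem finite_sections_projection:
  assumes "standard_borel N" and "standard_borel M"
    and P: "P \<in> sets (N \<Otimes>\<^sub>M M)" and fin: "\<And>x. x \<in> space N \<Longrightarrow> finite {y. (x, y) \<in> P}"
  shows "{x \<in> space N. \<exists>y. (x, y) \<in> P} \<in> sets N"
proof -
  obtain e where N: "borel_embedding N e"
    using standard_borel_embedding[OF assms(1)] by blast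
  obtain f where f: "borel_embedding M f" "f ` space M \<subseteq> {z. \<forall>i. 0 \<le> z i \<and> z i \<le> 1}"
    using standard_borel_embedding[OF assms(2)] by blast
  define P' where "P' = map_prod e f ` P"
  have PS: "P \<subseteq> space N \<times> space M"
    using sets.sets_into_space[OF P] by (simp add: space_pair_measure)
  have P'_iff: "(e x, b) \<in> P' \<longleftrightarrow> (\<exists>y. (x, y) \<in> P \<and> b = f y)" if "x \<in> space N" for x b
  proof
    assume "(e x, b) \<in> P'"
    then obtain x' y where *: "(x', y) \<in> P" "e x = e x'" "b = f y" by (auto simp: P'_def)
    moreover have "x' = x"
      using N * PS \<open>x \<in> space N\<close> by (auto simp: borel_embedding_def dest: inj_onD)
    ultimately show "\<exists>y. (x, y) \<in> P \<and> b = f y" by blast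
  qed (auto simp: P'_def intro!: image_eqI)
  have "fst ` P' \<in> sets borel"
  proof (rule borel_fst_image_compact)
    show "P' \<in> sets borel" unfolding P'_def by (rule map_prod_image_sets[OF N f(1) P])
    show "P' \<subseteq> UNIV \<times> {z. \<forall>i. 0 \<le> z i \<and> z i \<le> 1}" using PS f(2) by (auto simp: P'_def)
    show "closed {b. (a, b) \<in> P'}" for a
    proof (cases "a \<in> e ` space N")
      case True
      then obtain x where x: "x \<in> space N" "a = e x" by blast
      then have "{b. (a, b) \<in> P'} = f ` {y. (x, y) \<in> P}"
        using P'_iff by auto
      then show ?thesis using fin[OF x(1)] by (simp add: finite_imp_closed)
    next
      case False
      then have "{b. (a, b) \<in> P'} = {}" using PS by (auto simp: P'_def)
      then show ?thesis by simp
    qed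
  qed (rule compact_unit_cube)
  moreover have "e \<in> N \<rightarrow>\<^sub>M borel" using N by (simp add: borel_embedding_def)
  ultimately have "e -` (fst ` P') \<inter> space N \<in> sets N" by (rule measurable_sets[rotated])
  moreover have "e x \<in> fst ` P' \<longleftrightarrow> (\<exists>y. (x, y) \<in> P)" if "x \<in> space N" for x
  proof -
    have "e x \<in> fst ` P' \<longleftrightarrow> (\<exists>b. (e x, b) \<in> P')" by force
    then show ?thesis using P'_iff[OF that] by blast
  qed
  then have "e -` (fst ` P') \<inter> space N = {x \<in> space N. \<exists>y. (x, y) \<in> P}" by blast
  ultimately show ?thesis by simp
qed

section \<open>Borel enumerations of classes\<close>

text \<open>Preimages of a countable basis under an embedding: the image of a finite set is closed,
  so some basic open set contains a further point and misses it.\<close>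

lemma standard_borel_separating_sets:
  assumes "standard_borel M"
  obtains U :: "nat \<Rightarrow> 'a set" where "\<And>j. U j \<in> sets M"
    and "\<And>y A. y \<in> space M \<Longrightarrow> A \<subseteq> space M \<Longrightarrow> finite A \<Longrightarrow> y \<notin> A \<Longrightarrow> \<exists>j. y \<in> U j \<and> U j \<inter> A = {}"
proof -
  obtain e :: "'a \<Rightarrow> nat \<Rightarrow> real" where e: "inj_on e (space M)" "e \<in> M \<rightarrow>\<^sub>M borel"
    using standard_borel_embedding[OF assms] unfolding borel_embedding_def by blast
  obtain \<B> :: "(nat \<Rightarrow> real) set set" where \<B>: "countable \<B>" "topological_basis \<B>"
    using ex_countable_basis by metis
  define V where "V = from_nat_into \<B>"
  have "\<B> \<noteq> {}"
    using topological_basisE[OF \<B>(2) open_UNIV UNIV_I] by blast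
  then have rV: "range V = \<B>" using \<B>(1) by (simp add: V_def)
  then have oV: "open (V n)" for n using \<B>(2) topological_basis_open by blast
  show thesis
  proof (rule that)
    show "e -` V j \<inter> space M \<in> sets M" for j
      by (rule measurable_sets[OF e(2) borel_open[OF oV]])
    fix y A assume A: "y \<in> space M" "A \<subseteq> space M" "finite A" "y \<notin> A"
    have "open (- (e ` A))" using A(3) by (simp add: finite_imp_closed open_Compl)
    moreover have "e y \<in> - (e ` A)" using A e(1) by (auto dest: inj_onD)
    ultimately obtain B where B: "B \<in> \<B>" "e y \<in> B" "B \<subseteq> - (e ` A)"
      using topological_basisE[OF \<B>(2)] by blast
    then obtain j where "B = V j" using rV by blast
    then show "\<exists>j. y \<in> e -` V j \<inter> space M \<and> (e -` V j \<inter> space M) \<inter> A = {}"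
      using A B by blast
  qed
qed

text \<open>Countably many sets test equality. The one-sided implication suffices, since distinct
  values admit a \<open>U j\<close> that contains \<open>f x\<close> and misses
  \<open>g x\<close>.\<close>

lemma standard_borel_pred_eq:
  assumes M: "standard_borel M" and f: "f \<in> N \<rightarrow>\<^sub>M M" and g: "g \<in> N \<rightarrow>\<^sub>M M"
  shows "Measurable.pred N (\<lambda>x. f x = g x)"
proof -
  obtain U where U: "\<And>j::nat. U j \<in> sets M"
    and sep: "\<And>y A. y \<in> space M \<Longrightarrow> A \<subseteq> space M \<Longrightarrow> finite A \<Longrightarrow> y \<notin> A \<Longrightarrow> \<exists>j. y \<in> U j \<and> U j \<inter> A = {}"
    using standard_borel_separating_sets[OF M] by metis
  have [measurable]: "Measurable.pred N (\<lambda>x. f x \<in> U j)" "Measurable.pred N (\<lambda>x. g x \<in> U j)" for j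
    using U f g by measurable
  have "Measurable.pred N (\<lambda>x. \<forall>j. f x \<in> U j \<longrightarrow> g x \<in> U j)" by measurable
  moreover have "(\<forall>j. f x \<in> U j \<longrightarrow> g x \<in> U j) \<longleftrightarrow> f x = g x" if "x \<in> space N" for x
    using sep[of "f x" "{g x}"] measurable_space[OF f that] measurable_space[OF g that] by auto
  ultimately show ?thesis by (subst measurable_cong[where g = "\<lambda>x. \<forall>j. f x \<in> U j \<longrightarrow> g x \<in> U j"]) auto
qed

text \<open>
  \<open>T j\<close> is the set of points whose class meets the separating set \<open>U j\<close> in exactly one point.
  These isolated points enumerate a finite class, and the isolated point with the least
  index is a canonical representative.
\<close>

theorem finite_borel_equiv_enumeration:
  assumes M: "standard_borel M" and F: "borel_equiv M F" and fin: "finite_classes (space M) F"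
  obtains g :: "nat \<Rightarrow> 'a \<Rightarrow> 'a" and s :: "'a \<Rightarrow> 'a"
  where "\<And>j. g j \<in> M \<rightarrow>\<^sub>M M" and "\<And>x. x \<in> space M \<Longrightarrow> F `` {x} = range (\<lambda>j. g j x)"
    and "s \<in> M \<rightarrow>\<^sub>M M" and "\<And>x. x \<in> space M \<Longrightarrow> (x, s x) \<in> F"
    and "\<And>x y. (x, y) \<in> F \<Longrightarrow> s x = s y"
proof -
  let ?X = "space M"
  have FM: "F \<in> sets (M \<Otimes>\<^sub>M M)" and eq: "equiv ?X F" using F by (auto simp: borel_equiv_def)
  have FX: "F \<subseteq> ?X \<times> ?X" using sets.sets_into_space[OF FM] by (simp add: space_pair_measure)
  have Frefl: "(x, x) \<in> F" if "x \<in> ?X" for x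
    using eq that by (auto simp: equiv_def refl_on_def)
  have Fcl: "F `` {x} = F `` {y}" if "(x, y) \<in> F" for x y
    using equiv_class_eq[OF eq that] .
  obtain U where U: "\<And>j::nat. U j \<in> sets M"
    and sep: "\<And>y A. y \<in> ?X \<Longrightarrow> A \<subseteq> ?X \<Longrightarrow> finite A \<Longrightarrow> y \<notin> A \<Longrightarrow> \<exists>j. y \<in> U j \<and> U j \<inter> A = {}"
    using standard_borel_separating_sets[OF M] by metis
  \<comment> \<open>The saturation of a Borel set is a projection with finite sections; the
    measurability claims below are reduced to such saturations.\<close>
  have meets: "{x \<in> ?X. F `` {x} \<inter> B \<noteq> {}} \<in> sets M" if B: "B \<in> sets M" for B
  proof -
    have "{x \<in> ?X. \<exists>y. (x, y) \<in> F \<inter> ?X \<times> B} \<in> sets M"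
    proof (rule finite_sections_projection[OF M M])
      show "F \<inter> ?X \<times> B \<in> sets (M \<Otimes>\<^sub>M M)" using FM B by auto
      show "finite {y. (x, y) \<in> F \<inter> ?X \<times> B}" if "x \<in> ?X" for x
        using fin that by (auto simp: finite_classes_def intro: rev_finite_subset)
    qed
    moreover have "{x \<in> ?X. \<exists>y. (x, y) \<in> F \<inter> ?X \<times> B} = {x \<in> ?X. F `` {x} \<inter> B \<noteq> {}}" by auto
    ultimately show ?thesis by simp
  qed
  define T where "T j = {x \<in> ?X. \<exists>y. F `` {x} \<inter> U j = {y}}" for j
  have TM: "T j \<in> sets M" for j
  proof -
    \<comment> \<open>Exactly one point in \<open>U j\<close> means at least one, but no two that
      some \<open>U a\<close> tells apart.\<close>
    have "T j = {x \<in> ?X. F `` {x} \<inter> U j \<noteq> {}} -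
        (\<Union>a. {x \<in> ?X. F `` {x} \<inter> (U j \<inter> U a) \<noteq> {}} \<inter> {x \<in> ?X. F `` {x} \<inter> (U j - U a) \<noteq> {}})"
      (is "_ = ?D")
    proof (intro equalityI subsetI)
      fix x assume "x \<in> T j"
      then obtain y where xX: "x \<in> ?X" and y: "F `` {x} \<inter> U j = {y}" by (auto simp: T_def)
      have "F `` {x} \<inter> (U j \<inter> U a) = {y} \<inter> U a" "F `` {x} \<inter> (U j - U a) = {y} - U a" for a
        using y by blast+
      then show "x \<in> ?D" using xX y by auto
    next
      fix x assume x: "x \<in> ?D"
      then obtain y where y: "y \<in> F `` {x} \<inter> U j" and xX: "x \<in> ?X" by auto
      have "z = y" if z: "z \<in> F `` {x} \<inter> U j" for z
      proof (rule ccontr)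
        assume "z \<noteq> y"
        then obtain a where "z \<in> U a" "y \<notin> U a" using sep[of z "{y}"] y z FX by auto
        then have "x \<in> {x \<in> ?X. F `` {x} \<inter> (U j \<inter> U a) \<noteq> {}} \<inter> {x \<in> ?X. F `` {x} \<inter> (U j - U a) \<noteq> {}}"
          using y z xX by blast
        then show False using x by blast
      qed
      then have "F `` {x} \<inter> U j = {y}" using y by blast
      then show "x \<in> T j" using xX by (auto simp: T_def)
    qed
    moreover have "?D \<in> sets M"
      by (intro sets.Diff sets.countable_UN image_subsetI sets.Int meets U)
    ultimately show ?thesis by simp
  qed
  define pt where "pt x j = (THE y. F `` {x} \<inter> U j = {y})" for x j
  have pt: "F `` {x} \<inter> U j = {pt x j}" if xT: "x \<in> T j" for x j
  proof -
    obtain y where y: "F `` {x} \<inter> U j = {y}" using xT by (auto simp: T_def)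
    then have "pt x j = y" unfolding pt_def by (intro the_equality) auto
    then show ?thesis using y by simp
  qed
  have iso: "\<exists>j. x \<in> T j \<and> pt x j = y" if "(x, y) \<in> F" for x y
  proof -
    have xy: "x \<in> ?X" "y \<in> ?X" using FX that by auto
    obtain j where j: "y \<in> U j" "U j \<inter> (F `` {x} - {y}) = {}"
      using sep[of y "F `` {x} - {y}"] xy FX fin by (auto simp: finite_classes_def)
    then have "F `` {x} \<inter> U j = {y}" using that by blast
    then have "x \<in> T j" using xy by (auto simp: T_def)
    then show ?thesis using pt \<open>F `` {x} \<inter> U j = {y}\<close> by blast
  qed
  \<comment> \<open>The default \<open>x\<close> lies in its own class, so it adds nothing to the
    range.\<close>
  define g where "g j x = (if x \<in> T j then pt x j else x)" for j x
  have gF: "(x, g j x) \<in> F" if "x \<in> ?X" for x j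
    using pt[of x j] Frefl[OF that] by (auto simp: g_def)
  have gM: "g j \<in> M \<rightarrow>\<^sub>M M" for j
  proof (rule measurableI)
    show "g j x \<in> ?X" if "x \<in> ?X" for x using gF[OF that] FX by blast
    fix B assume B: "B \<in> sets M"
    have "g j -` B \<inter> ?X = (T j \<inter> {x \<in> ?X. F `` {x} \<inter> (U j \<inter> B) \<noteq> {}}) \<union> (B - T j)"
    proof (intro set_eqI)
      fix x
      show "x \<in> g j -` B \<inter> ?X \<longleftrightarrow> x \<in> (T j \<inter> {x \<in> ?X. F `` {x} \<inter> (U j \<inter> B) \<noteq> {}}) \<union> (B - T j)"
      proof (cases "x \<in> T j")
        case True
        then have "F `` {x} \<inter> (U j \<inter> B) = {pt x j} \<inter> B" using pt[of x j] by blast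
        then show ?thesis using True by (auto simp: g_def T_def)
      next
        case False
        then show ?thesis using sets.sets_into_space[OF B] by (auto simp: g_def)
      qed
    qed
    then show "g j -` B \<inter> ?X \<in> sets M" using TM meets U B by auto
  qed
  define s where "s x = g (LEAST j. x \<in> T j) x" for x
  have "s \<in> M \<rightarrow>\<^sub>M M"
    unfolding s_def
  proof (rule measurable_compose_countable)
    show "(\<lambda>x. LEAST j. x \<in> T j) \<in> M \<rightarrow>\<^sub>M count_space UNIV"
      using TM by measurable
  qed (rule gM)
  moreover have "(x, s x) \<in> F" if "x \<in> ?X" for x using gF[OF that] by (simp add: s_def)
  moreover have "s x = s y" if xy: "(x, y) \<in> F" for x y
  proof -
    have "x \<in> ?X" "y \<in> ?X" using xy FX by auto
    then have T: "x \<in> T j \<longleftrightarrow> y \<in> T j" for j using Fcl[OF xy] by (simp add: T_def)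
    obtain j where "x \<in> T j" using iso[OF xy] by blast
    then have "x \<in> T (LEAST j. x \<in> T j)" by (rule LeastI)
    then show ?thesis using T Fcl[OF xy] by (simp add: s_def g_def pt_def)
  qed
  moreover have "F `` {x} = range (\<lambda>j. g j x)" if "x \<in> ?X" for x
  proof (intro equalityI subsetI)
    fix y assume "y \<in> F `` {x}"
    then obtain j where "x \<in> T j" "pt x j = y" using iso by blast
    then show "y \<in> range (\<lambda>j. g j x)" by (intro image_eqI[of _ _ j]) (auto simp: g_def)
  qed (use gF[OF that] in auto)
  ultimately show thesis using gM that by blast
qed

lemma hyperfinite_enumeration:
  assumes M: "standard_borel M" and E: "hyperfinite M E"
  obtains G :: "nat \<Rightarrow> 'a \<Rightarrow> 'a" where "\<And>m. G m \<in> M \<rightarrow>\<^sub>M M"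
    and "\<And>x. x \<in> space M \<Longrightarrow> E `` {x} = range (\<lambda>m. G m x)"
proof -
  obtain F where F: "\<And>i::nat. borel_equiv M (F i)" "\<And>i. finite_classes (space M) (F i)" "E = (\<Union>i. F i)"
    using E unfolding hyperfinite_def by metis
  have "\<exists>g. (\<forall>j::nat. g j \<in> M \<rightarrow>\<^sub>M M) \<and> (\<forall>x\<in>space M. F i `` {x} = range (\<lambda>j. g j x))" for i
    using finite_borel_equiv_enumeration[OF M F(1,2)] by metis
  then obtain g where g: "\<And>i j::nat. g i j \<in> M \<rightarrow>\<^sub>M M"
    "\<And>i x. x \<in> space M \<Longrightarrow> F i `` {x} = range (\<lambda>j. g i j x)" by metis
  define G where "G m = g (fst (prod_decode m)) (snd (prod_decode m))" for m
  show thesis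
  proof (rule that)
    show "G m \<in> M \<rightarrow>\<^sub>M M" for m unfolding G_def by (rule g(1))
    show "E `` {x} = range (\<lambda>m. G m x)" if x: "x \<in> space M" for x
    proof -
      have "E `` {x} = (\<Union>i. F i `` {x})" using F(3) by blast
      also have "\<dots> = (\<Union>i. range (\<lambda>j. g i j x))" using g(2)[OF x] by simp
      also have "\<dots> = range (\<lambda>m. G m x)"
      proof (intro equalityI subsetI)
        fix y assume "y \<in> (\<Union>i. range (\<lambda>j. g i j x))"
        then obtain i j where "y = g i j x" by blast
        then show "y \<in> range (\<lambda>m. G m x)"
          by (intro image_eqI[of _ _ "prod_encode (i, j)"]) (auto simp: G_def)
      qed (auto simp: G_def)
      finally show ?thesis .
    qed
  qed
qed

section \<open>Colourings of class subsets\<close>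

text \<open>Turns the definite description in \<open>incr_list\<close> into a count of predecessors,
  a condition on finitely many pairs and thus accessible to measurability.\<close>

lemma incr_list_rank:
  assumes R: "strict_linear_order_on X R" and A: "A \<in> nsets X n" and y: "y \<in> A"
  shows "card {z \<in> A. (z, y) \<in> R} = i \<longleftrightarrow> i < n \<and> y = incr_list R n A i"
proof -
  let ?L = "incr_list R n A"
  have bij: "bij_betw ?L {..<n} A" and mono: "\<And>i j. i < j \<Longrightarrow> j < n \<Longrightarrow> (?L i, ?L j) \<in> R"
    using incr_list_bij_betw[OF R A] by blast+
  have tr: "trans R" and ir: "irrefl R"
    using R by (auto simp: strict_linear_order_on_def)
  have inj: "inj_on ?L {..<n}" and im: "?L ` {..<n} = A" using bij by (auto simp: bij_betw_def)
  have rank: "card {z \<in> A. (z, ?L j) \<in> R} = j" if "j < n" for j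
  proof -
    have "{z \<in> A. (z, ?L j) \<in> R} = ?L ` {..<j}"
    proof (intro equalityI subsetI)
      fix z assume z: "z \<in> {z \<in> A. (z, ?L j) \<in> R}"
      then obtain l where l: "l < n" "z = ?L l" using im by auto
      have "\<not> j \<le> l"
      proof
        assume "j \<le> l"
        then have "(?L j, ?L l) \<in> R \<or> ?L j = ?L l" using mono[of j l] l(1) by (cases "j = l") auto
        then have "(?L j, ?L j) \<in> R" using z l tr by (auto dest: transD)
        then show False using ir by (auto simp: irrefl_def)
      qed
      then show "z \<in> ?L ` {..<j}" using l by auto
    next
      fix z assume "z \<in> ?L ` {..<j}"
      then show "z \<in> {z \<in> A. (z, ?L j) \<in> R}" using mono[OF _ that] im that by auto
    qed
    moreover have "inj_on ?L {..<j}" using inj that by (auto intro: inj_on_subset)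
    ultimately show ?thesis by (simp add: card_image)
  qed
  obtain j where j: "j < n" "y = ?L j" using y im by auto
  then have "card {z \<in> A. (z, y) \<in> R} = j" using rank by simp
  moreover have "?L j = ?L i \<Longrightarrow> i < n \<Longrightarrow> j = i" using inj j(1) by (auto dest: inj_onD)
  ultimately show ?thesis using j by auto
qed

text \<open>The bridge from the Borel structure on \<open>n\<close>-sets to points: where the
  \<open>h i x\<close> are distinct, the increasing listing of the \<open>n\<close>-set they form
  depends measurably on \<open>x\<close>, and \<open>c\<close> can be composed with it.\<close>

lemma borel_coloring_pred:
  assumes M: "standard_borel M" and R: "borel_linear_order M R"
    and E: "equiv (space M) E" and c: "borel_coloring M R E n k c"
    and h: "\<And>i. i < n \<Longrightarrow> h i \<in> M \<rightarrow>\<^sub>M M" "\<And>i x. i < n \<Longrightarrow> x \<in> space M \<Longrightarrow> (x, h i x) \<in> E"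
  shows "Measurable.pred M (\<lambda>x. inj_on (\<lambda>i. h i x) {..<n} \<and> c ((\<lambda>i. h i x) ` {..<n}) = q)"
proof -
  have Rlin: "strict_linear_order_on (space M) R" and RM: "R \<in> sets (M \<Otimes>\<^sub>M M)"
    using R by (auto simp: borel_linear_order_def)
  define Y where "Y = {x \<in> space M. inj_on (\<lambda>i. h i x) {..<n}}"
  define A where "A x = (\<lambda>i. h i x) ` {..<n}" for x
  have hX: "h i x \<in> space M" if "i < n" "x \<in> space M" for i x
    using measurable_space[OF h(1)] that by blast
  have "{x \<in> space M. \<forall>i\<in>{..<n}. \<forall>j\<in>{..<n}. h i x = h j x \<longrightarrow> i = j} \<in> sets M"
  proof (intro sets.sets_Collect_finite_All sets.sets_Collect_imp)
    show "{x \<in> space M. h i x = h j x} \<in> sets M" if "i \<in> {..<n}" "j \<in> {..<n}" for i j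
      using standard_borel_pred_eq[OF M h(1) h(1)] that by (auto simp: pred_def)
  qed auto
  then have YM: "Y \<in> sets M" by (simp add: Y_def inj_on_def)
  have Rpred: "{x \<in> space M. (h l x, h j x) \<in> R} \<in> sets M" if "l < n" "j < n" for l j
    using measurable_sets[OF measurable_Pair[OF h(1)[OF that(1)] h(1)[OF that(2)]] RM]
    by (simp add: vimage_def Int_def conj_commute)
  have Acls: "A x \<in> class_nsets (space M) E n" if "x \<in> Y" for x
    using that hX h(2) by (auto simp: class_nsets_def nsets_def A_def Y_def card_image intro!: bexI[of _ x])
  have Ans: "A x \<in> nsets (space M) n" if "x \<in> Y" for x
    using Acls[OF that] by (auto simp: class_nsets_def)
  let ?N = "restrict_space M Y"
  have spN: "space ?N = Y" using sets.sets_into_space[OF YM] by (auto simp: space_restrict_space)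
  have setsN: "S \<in> sets ?N \<longleftrightarrow> S \<subseteq> Y \<and> S \<in> sets M" for S
    using YM by (subst sets_restrict_space_iff) (auto simp: sets.Int_space_eq2)
  have rank: "card {l \<in> {..<n}. (h l x, h j x) \<in> R} = i \<longleftrightarrow> i < n \<and> h j x = incr_list R n (A x) i"
    if x: "x \<in> Y" and j: "j < n" for x i j
  proof -
    have "{z \<in> A x. (z, h j x) \<in> R} = (\<lambda>l. h l x) ` {l \<in> {..<n}. (h l x, h j x) \<in> R}"
      by (auto simp: A_def)
    moreover have "inj_on (\<lambda>l. h l x) {l \<in> {..<n}. (h l x, h j x) \<in> R}"
      using x by (auto simp: Y_def intro: inj_on_subset)
    ultimately have "card {z \<in> A x. (z, h j x) \<in> R} = card {l \<in> {..<n}. (h l x, h j x) \<in> R}"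
      by (simp add: card_image)
    moreover have "h j x \<in> A x" using j by (auto simp: A_def)
    ultimately show ?thesis using incr_list_rank[OF Rlin Ans[OF x]] by metis
  qed
  have "(\<lambda>x. \<lambda>i\<in>{..<n}. incr_list R n (A x) i) \<in> ?N \<rightarrow>\<^sub>M Pi\<^sub>M {..<n} (\<lambda>_. M)"
  proof (rule measurable_restrict, rule measurableI)
    fix i assume i: "i \<in> {..<n}"
    have val: "\<exists>j<n. incr_list R n (A x) i = h j x" if "x \<in> Y" for x
      using incr_list_bij_betw(1)[OF Rlin Ans[OF that]] i by (auto simp: bij_betw_def A_def)
    show "incr_list R n (A x) i \<in> space M" if "x \<in> space ?N" for x
    proof -
      have "x \<in> Y" using that spN by simp
      moreover obtain j where "j < n" "incr_list R n (A x) i = h j x" using val[OF calculation] by blast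
      ultimately show ?thesis using hX by (simp add: Y_def)
    qed
    fix B assume B: "B \<in> sets M"
    have hB: "{x \<in> space M. h j x \<in> B} \<in> sets M" if "j < n" for j
      using measurable_sets[OF h(1)[OF that] B] by (simp add: vimage_def Int_def conj_commute)
    \<comment> \<open>Entry \<open>i\<close> of the listing is the \<open>h j x\<close> with exactly
      \<open>i\<close> predecessors; splitting by \<open>j\<close> leaves finitely many Borel
      conditions.\<close>
    have eq: "(\<lambda>x. incr_list R n (A x) i) -` B \<inter> Y =
        Y \<inter> (\<Union>j\<in>{..<n}. {x \<in> space M. h j x \<in> B} \<inter>
          {x \<in> space M. card {l \<in> {..<n}. (h l x, h j x) \<in> R} = i})"
    proof (intro set_eqI)
      fix x
      show "x \<in> (\<lambda>x. incr_list R n (A x) i) -` B \<inter> Y \<longleftrightarrow>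
        x \<in> Y \<inter> (\<Union>j\<in>{..<n}. {x \<in> space M. h j x \<in> B} \<inter>
          {x \<in> space M. card {l \<in> {..<n}. (h l x, h j x) \<in> R} = i})"
      proof (cases "x \<in> Y")
        case True
        then show ?thesis using rank[OF True, where i = i] val[OF True] i by (auto simp: Y_def)
      qed simp
    qed
    have cardM: "{x \<in> space M. card {l \<in> {..<n}. (h l x, h j x) \<in> R} = i} \<in> sets M" if j: "j < n" for j
    proof -
      have "{x \<in> space M. l \<in> {l \<in> {..<n}. (h l x, h j x) \<in> R}} \<in> sets M" for l
        using Rpred[of l j] j by (cases "l < n") auto
      then have "(\<lambda>x. card {l \<in> {..<n}. (h l x, h j x) \<in> R}) \<in> M \<rightarrow>\<^sub>M count_space UNIV"
        by (rule measurable_card)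
      then have "(\<lambda>x. card {l \<in> {..<n}. (h l x, h j x) \<in> R}) -` {i} \<inter> space M \<in> sets M"
        by (rule measurable_sets) simp
      also have "(\<lambda>x. card {l \<in> {..<n}. (h l x, h j x) \<in> R}) -` {i} \<inter> space M =
          {x \<in> space M. card {l \<in> {..<n}. (h l x, h j x) \<in> R} = i}" by blast
      finally show ?thesis .
    qed
    have "(\<lambda>x. incr_list R n (A x) i) -` B \<inter> Y \<in> sets M"
      unfolding eq
      by (rule sets.Int[OF YM], rule sets.finite_UN, simp, rule sets.Int[OF hB cardM]) auto
    then show "(\<lambda>x. incr_list R n (A x) i) -` B \<inter> space ?N \<in> sets ?N"
      unfolding spN setsN by blast
  qed
  moreover have "(\<lambda>i\<in>{..<n}. incr_list R n (A x) i) = incr_list R n (A x)" for x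
    unfolding incr_list_def by (simp only: restrict_restrict Int_absorb)
  ultimately have "(\<lambda>x. incr_list R n (A x)) \<in> ?N \<rightarrow>\<^sub>M Pi\<^sub>M {..<n} (\<lambda>_. M)" by simp
  then have "A \<in> ?N \<rightarrow>\<^sub>M class_nsets_space M R E n"
    unfolding class_nsets_space_def using Acls spN by (intro measurable_vimage_algebra2) auto
  then have cA: "(\<lambda>x. c (A x)) \<in> ?N \<rightarrow>\<^sub>M count_space {1..k}"
    using c unfolding borel_coloring_def by (rule measurable_compose)
  have "(\<lambda>x. c (A x)) -` ({q} \<inter> {1..k}) \<inter> space ?N \<in> sets ?N"
    by (rule measurable_sets[OF cA]) simp
  also have "(\<lambda>x. c (A x)) -` ({q} \<inter> {1..k}) \<inter> space ?N = {x \<in> Y. c (A x) = q}"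
    using measurable_space[OF cA] by (auto simp: spN)
  finally have "{x \<in> Y. c (A x) = q} \<in> sets M" by (simp add: setsN)
  then show ?thesis by (simp add: pred_def Y_def A_def conj_assoc)
qed

text \<open>Replaces subsets by index lists, of which there are only countably many. Distinctness
  concerns the values, as the enumeration may repeat.\<close>

lemma nsets_range_iff:
  "B \<in> nsets (range f) m \<longleftrightarrow>
     (\<exists>ls. length ls = m \<and> distinct (map f ls) \<and> B = set (map f ls))"
proof
  assume B: "B \<in> nsets (range f) m"
  then obtain bs where bs: "set bs = B" "distinct bs" "length bs = m"
    using finite_distinct_list[of B] by (auto simp: nsets_def distinct_card)
  moreover have "\<exists>ls. bs = map f ls" using bs(1) B by (auto simp: ex_map_conv nsets_def)
  ultimately show "\<exists>ls. length ls = m \<and> distinct (map f ls) \<and> B = set (map f ls)" by auto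
next
  assume "\<exists>ls. length ls = m \<and> distinct (map f ls) \<and> B = set (map f ls)"
  then obtain ls where "length ls = m" "distinct (map f ls)" "B = set (map f ls)" by blast
  then show "B \<in> nsets (range f) m"
    using distinct_card[of "map f ls"] by (auto simp: nsets_def)
qed

text \<open>No finite list of indices exhausts an infinite set; in this form both quantifiers are
  countable.\<close>

lemma infinite_subset_range_iff:
  assumes "S \<subseteq> range f"
  shows "infinite S \<longleftrightarrow> (\<forall>L. \<exists>m. f m \<in> S \<and> f m \<notin> set (map f L))"
proof
  assume inf: "infinite S"
  show "\<forall>L. \<exists>m. f m \<in> S \<and> f m \<notin> set (map f L)"
  proof
    fix L
    have "\<not> S \<subseteq> set (map f L)" using inf finite_subset[OF _ List.finite_set] by blast
    then show "\<exists>m. f m \<in> S \<and> f m \<notin> set (map f L)" using assms by blast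
  qed
next
  assume *: "\<forall>L. \<exists>m. f m \<in> S \<and> f m \<notin> set (map f L)"
  show "infinite S"
  proof
    assume "finite S"
    then obtain ss where "set ss = S" using finite_list by blast
    then obtain L where "set (map f L) = S" using assms by (metis ex_map_conv image_iff subset_iff)
    then show False using * by blast
  qed
qed

section \<open>Colours realised infinitely often in a class\<close>

definition infinite_color :: "'a set \<Rightarrow> nat \<Rightarrow> ('a set \<Rightarrow> nat) \<Rightarrow> nat \<Rightarrow> bool" where
  "infinite_color C n c q \<longleftrightarrow>
     (\<exists>B\<in>nsets C (n - 1). infinite {z \<in> C - B. c (insert z B) = q})"

text \<open>Pigeonhole over the one-point extensions of a single \<open>(n - 1)\<close>-set;
  infinite classes and finitely many colours enter here.\<close>

lemma infinite_color_exists: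
  assumes C: "infinite C" and n: "n \<ge> 1" and c: "\<And>A. A \<in> nsets C n \<Longrightarrow> c A \<in> {1..k}"
  shows "\<exists>q. infinite_color C n c q"
proof -
  obtain B where B: "B \<subseteq> C" "finite B" "card B = n - 1"
    using infinite_arbitrarily_large[OF C] by blast
  have "infinite (C - B)" using C B by simp
  moreover have "(\<lambda>z. c (insert z B)) ` (C - B) \<subseteq> {1..k}"
    using B n by (intro image_subsetI c) (simp add: nsets_def)
  then have "finite ((\<lambda>z. c (insert z B)) ` (C - B))" by (rule finite_subset) simp
  ultimately obtain z0 where "infinite {z \<in> C - B. c (insert z B) = c (insert z0 B)}"
    using pigeonhole_infinite by blast
  then show ?thesis using B by (auto simp: infinite_color_def nsets_def)
qed

text \<open>By almost transitivity, the infinitely many points realising the colour over one set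
  realise it over every set of a given finite family, up to finitely many exceptions.\<close>

lemma infinite_color_extend:
  assumes E: "equiv X E" and x: "x \<in> X" and n: "n \<ge> 1" and trans: "almost_transitive X E n c"
    and inf: "infinite_color (E `` {x}) n c q" and A: "finite A" "A \<subseteq> E `` {x}"
  shows "\<exists>z \<in> E `` {x} - A. \<forall>B \<in> nsets A (n - 1). c (insert z B) = q"
proof -
  let ?C = "E `` {x}"
  obtain B0 where B0: "B0 \<in> nsets ?C (n - 1)" "infinite {z \<in> ?C - B0. c (insert z B0) = q}"
    using inf unfolding infinite_color_def by blast
  obtain w where w: "w \<in> ?C - B0"
    using infinite_imp_nonempty[OF B0(2)] by blast
  \<comment> \<open>Almost transitivity speaks of sets with at least \<open>n\<close> elements;
    \<open>w\<close> enlarges \<open>B0\<close>, which has only \<open>n - 1\<close>.\<close>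
  define A' where "A' = insert w (A \<union> B0)"
  have fin: "finite A'" using A B0 by (simp add: A'_def nsets_def)
  have sub: "A' \<subseteq> ?C" using w A B0 by (auto simp: A'_def nsets_def)
  have "card (insert w B0) \<le> card A'" by (rule card_mono[OF fin]) (auto simp: A'_def)
  then have card: "card A' \<ge> n" using w B0 n by (simp add: nsets_def)
  have EX: "E \<subseteq> X \<times> X" using E by (simp add: equiv_def)
  have cls: "A' \<in> class_nsets X E (card A')"
    using fin sub x EX by (auto simp: class_nsets_def nsets_def)
  have EA': "E `` A' = ?C"
  proof (intro equalityI subsetI)
    fix z assume "z \<in> E `` A'"
    then obtain a where "a \<in> A'" "(a, z) \<in> E" by blast
    then show "z \<in> ?C" using sub E by (auto simp: equiv_def dest: transD)
  next
    fix z assume "z \<in> ?C"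
    then have "(w, z) \<in> E" using w E by (auto simp: equiv_def dest: symD transD)
    then show "z \<in> E `` A'" by (auto simp: A'_def)
  qed
  have ex: "finite {z \<in> ?C - (B0 \<union> B). c (insert z B0) \<noteq> c (insert z B)}"
    if "B \<in> nsets A (n - 1)" for B
  proof -
    have "B0 \<in> nsets A' (n - 1)" "B \<in> nsets A' (n - 1)"
      using that B0 by (auto simp: nsets_def A'_def)
    then show ?thesis
      using trans card cls unfolding almost_transitive_def EA'[symmetric] by simp
  qed
  define Bad where "Bad = A \<union> (\<Union>B\<in>nsets A (n - 1). {z \<in> ?C - (B0 \<union> B). c (insert z B0) \<noteq> c (insert z B)})"
  have "finite Bad" unfolding Bad_def using A(1) ex by (auto intro: finite_imp_finite_nsets)
  then have "infinite ({z \<in> ?C - B0. c (insert z B0) = q} - Bad)" using B0(2) by simp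
  then obtain z where z: "z \<in> ?C - B0" "c (insert z B0) = q" "z \<notin> Bad"
    using infinite_imp_nonempty by blast
  have "c (insert z B) = q" if "B \<in> nsets A (n - 1)" for B
  proof -
    have "z \<notin> B" using z(3) that by (auto simp: Bad_def nsets_def)
    then show ?thesis using z that by (auto simp: Bad_def)
  qed
  then show ?thesis using z by (auto simp: Bad_def)
qed

section \<open>The reduction\<close>

locale hyperfinite_coloring =
  fixes M :: "'a measure" and R E :: "'a rel" and n k :: nat and c :: "'a set \<Rightarrow> nat"
    and F :: "nat \<Rightarrow> 'a rel" and G :: "nat \<Rightarrow> 'a \<Rightarrow> 'a" and g :: "nat \<Rightarrow> nat \<Rightarrow> 'a \<Rightarrow> 'a"
    and s :: "nat \<Rightarrow> 'a \<Rightarrow> 'a"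
  assumes M: "standard_borel M" and R: "borel_linear_order M R"
    and E: "equiv (space M) E" and aper: "aperiodic (space M) E" and n: "n \<ge> 1"
    and c: "borel_coloring M R E n k c" and trans: "almost_transitive (space M) E n c"
    and F_mono: "incseq F" and F: "\<And>i. equiv (space M) (F i)"
    and F_fin: "\<And>i. finite_classes (space M) (F i)" and F_Un: "E = (\<Union>i. F i)"
    and G_meas [measurable]: "\<And>m. G m \<in> M \<rightarrow>\<^sub>M M"
    and G_range: "\<And>x. x \<in> space M \<Longrightarrow> E `` {x} = range (\<lambda>m. G m x)"
    and g_meas [measurable]: "\<And>i m. g i m \<in> M \<rightarrow>\<^sub>M M"
    and g_range: "\<And>i x. x \<in> space M \<Longrightarrow> F i `` {x} = range (\<lambda>m. g i m x)"
    and s_meas [measurable]: "\<And>i. s i \<in> M \<rightarrow>\<^sub>M M"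
    and s_F: "\<And>i x. x \<in> space M \<Longrightarrow> (x, s i x) \<in> F i"
    and s_eq: "\<And>i x y. (x, y) \<in> F i \<Longrightarrow> s i x = s i y"
begin

abbreviation X where "X \<equiv> space M"

lemma E_X: "(x, y) \<in> E \<Longrightarrow> x \<in> X \<and> y \<in> X"
  using E by (auto simp: equiv_def)

lemma E_class: "(x, y) \<in> E \<Longrightarrow> E `` {x} = E `` {y}"
  using equiv_class_eq[OF E] by blast

lemma E_refl: "x \<in> X \<Longrightarrow> (x, x) \<in> E"
  using E by (auto simp: equiv_def refl_on_def)

lemma F_refl: "x \<in> X \<Longrightarrow> (x, x) \<in> F i"
  using F[of i] by (auto simp: equiv_def refl_on_def)

lemma F_E: "(x, y) \<in> F i \<Longrightarrow> (x, y) \<in> E"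
  using F_Un by blast

section \<open>Borel dependence of the colour on the point\<close>

definition color_at :: "('a \<Rightarrow> 'a) list \<Rightarrow> nat \<Rightarrow> 'a \<Rightarrow> bool" where
  "color_at fs q x \<longleftrightarrow> length fs = n \<and> distinct (map (\<lambda>f. f x) fs) \<and> c (set (map (\<lambda>f. f x) fs)) = q"

lemma color_at_pred:
  assumes "\<And>f. f \<in> set fs \<Longrightarrow> f \<in> M \<rightarrow>\<^sub>M M" "\<And>f x. f \<in> set fs \<Longrightarrow> x \<in> X \<Longrightarrow> (x, f x) \<in> E"
  shows "Measurable.pred M (color_at fs q)"
proof (cases "length fs = n")
  case True
  have "Measurable.pred M (\<lambda>x. inj_on (\<lambda>i. (fs ! i) x) {..<n} \<and> c ((\<lambda>i. (fs ! i) x) ` {..<n}) = q)"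
    using assms True by (intro borel_coloring_pred[OF M R E c]) auto
  moreover have "inj_on (\<lambda>i. (fs ! i) x) {..<n} \<longleftrightarrow> distinct (map (\<lambda>f. f x) fs)" for x
    using True by (auto simp: distinct_conv_nth inj_on_def)
  moreover have "(\<lambda>i. (fs ! i) x) ` {..<n} = set (map (\<lambda>f. f x) fs)" for x
    using True by (simp add: set_eq_iff image_iff in_set_conv_nth Bex_def) metis
  ultimately show ?thesis by (simp add: color_at_def[abs_def] True)
next
  case False
  then show ?thesis by (simp add: color_at_def[abs_def])
qed

lemma G_E: "x \<in> X \<Longrightarrow> (x, G m x) \<in> E"
  using G_range by blast

text \<open>Only countable quantifiers remain: \<open>ls\<close> indexes the base set, and the lists
  \<open>L\<close> of points to be avoided express infinitude. Distinctness in
  \<open>color_at\<close> keeps the new point outside the base set.\<close>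

lemma infinite_color_iff:
  assumes x: "x \<in> X"
  shows "infinite_color (E `` {x}) n c q \<longleftrightarrow>
    (\<exists>ls. \<forall>L. \<exists>m. color_at (map G (m # ls)) q x \<and> (\<forall>l\<in>set L. G m x \<noteq> G l x))"
    (is "_ \<longleftrightarrow> (\<exists>ls. ?P ls)")
proof
  assume "infinite_color (E `` {x}) n c q"
  then obtain B where "B \<in> nsets (range (\<lambda>m. G m x)) (n - 1)"
    and inf: "infinite {z \<in> E `` {x} - B. c (insert z B) = q}"
    unfolding infinite_color_def G_range[OF x] by blast
  then obtain ls where ls: "length ls = n - 1" "distinct (map (\<lambda>l. G l x) ls)" "B = set (map (\<lambda>l. G l x) ls)"
    unfolding nsets_range_iff by blast
  have sub: "{z \<in> E `` {x} - B. c (insert z B) = q} \<subseteq> range (\<lambda>m. G m x)"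
    using G_range[OF x] by blast
  have "?P ls"
  proof
    fix L
    obtain m where m: "G m x \<in> {z \<in> E `` {x} - B. c (insert z B) = q}" "G m x \<notin> set (map (\<lambda>m. G m x) L)"
      using inf unfolding infinite_subset_range_iff[OF sub] by blast
    then have "color_at (map G (m # ls)) q x"
      using ls n by (simp add: color_at_def comp_def image_image)
    then show "\<exists>m. color_at (map G (m # ls)) q x \<and> (\<forall>l\<in>set L. G m x \<noteq> G l x)"
      using m(2) by (intro exI[of _ m]) auto
  qed
  then show "\<exists>ls. ?P ls" by blast
next
  assume "\<exists>ls. ?P ls"
  then obtain ls where ls: "?P ls" by blast
  define B where "B = set (map (\<lambda>l. G l x) ls)"
  from ls obtain m where "color_at (map G (m # ls)) q x" by blast
  then have "length ls = n - 1" "distinct (map (\<lambda>l. G l x) ls)"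
    by (auto simp: color_at_def comp_def)
  then have "B \<in> nsets (range (\<lambda>m. G m x)) (n - 1)"
    unfolding nsets_range_iff B_def by blast
  then have "B \<in> nsets (E `` {x}) (n - 1)" using G_range[OF x] by simp
  moreover have "infinite {z \<in> E `` {x} - B. c (insert z B) = q}"
  proof (subst infinite_subset_range_iff[where f = "\<lambda>m. G m x"])
    show "{z \<in> E `` {x} - B. c (insert z B) = q} \<subseteq> range (\<lambda>m. G m x)"
      using G_range[OF x] by blast
    show "\<forall>L. \<exists>m. G m x \<in> {z \<in> E `` {x} - B. c (insert z B) = q} \<and> G m x \<notin> set (map (\<lambda>m. G m x) L)"
    proof
      fix L
      obtain m where m: "color_at (map G (m # ls)) q x" "\<forall>l\<in>set L. G m x \<noteq> G l x" using ls by blast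
      have "G m x \<notin> B" "c (insert (G m x) B) = q"
        using m(1) by (auto simp: color_at_def B_def comp_def image_image)
      moreover have "G m x \<in> E `` {x}" using G_E[OF x] by simp
      ultimately show "\<exists>m. G m x \<in> {z \<in> E `` {x} - B. c (insert z B) = q} \<and> G m x \<notin> set (map (\<lambda>m. G m x) L)"
        using m(2) by (intro exI[of _ m]) auto
    qed
  qed
  ultimately show "infinite_color (E `` {x}) n c q" unfolding infinite_color_def by blast
qed

text \<open>Taking the least colour makes the choice Borel and invariant under
  \<open>E\<close>.\<close>

definition col :: "'a \<Rightarrow> nat" where
  "col x = (LEAST q. infinite_color (E `` {x}) n c q)"

lemma col_E: "(x, y) \<in> E \<Longrightarrow> col x = col y"
  using E_class by (simp add: col_def)

lemma infinite_color_col: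
  assumes x: "x \<in> X"
  shows "infinite_color (E `` {x}) n c (col x)"
proof -
  have "\<exists>q. infinite_color (E `` {x}) n c q"
  proof (rule infinite_color_exists[OF _ n])
    show "infinite (E `` {x})" using aper x by (simp add: aperiodic_def)
    show "c A \<in> {1..k}" if A: "A \<in> nsets (E `` {x}) n" for A
    proof -
      have "A \<in> class_nsets X E n"
        using A x E_X by (auto simp: class_nsets_def nsets_def)
      then show ?thesis
        using measurable_space[OF c[unfolded borel_coloring_def], of A]
        by (simp add: class_nsets_space_def)
    qed
  qed
  then show ?thesis unfolding col_def by (rule LeastI_ex)
qed

lemma col_measurable [measurable]: "col \<in> M \<rightarrow>\<^sub>M count_space UNIV"
proof -
  have [measurable]: "Measurable.pred M (color_at (map G (m # ls)) q)" for m ls q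
    by (rule color_at_pred) (auto simp: G_E)
  have [measurable]: "Measurable.pred M (\<lambda>x. G m x \<noteq> G l x)" for m l
    using standard_borel_pred_eq[OF M G_meas G_meas] by (rule pred_intros_logic)
  have "Measurable.pred M (\<lambda>x. \<exists>ls. \<forall>L. \<exists>m. color_at (map G (m # ls)) q x \<and> (\<forall>l\<in>set L. G m x \<noteq> G l x))" for q
    by measurable
  then have "Measurable.pred M (\<lambda>x. infinite_color (E `` {x}) n c q)" for q
    by (subst measurable_cong[OF infinite_color_iff])
  then show ?thesis unfolding col_def by (rule measurable_Least)
qed

text \<open>The first condition yields injectivity, the second homogeneity: it controls every
  \<open>n\<close>-set that \<open>z\<close> completes from \<open>A\<close>.\<close>

definition good :: "'a set \<Rightarrow> 'a \<Rightarrow> 'a \<Rightarrow> bool" where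
  "good A x z \<longleftrightarrow> z \<notin> A \<and> (\<forall>B\<in>nsets A (n - 1). c (insert z B) = col x)"

text \<open>The result may vary with \<open>x\<close> within a class, through the enumeration
  \<open>G\<close>; \<open>pt\<close> therefore evaluates it at a canonical representative.\<close>

definition pick :: "'a set \<Rightarrow> 'a \<Rightarrow> 'a" where
  "pick A x = G (LEAST m. good A x (G m x)) x"

lemma good_pick:
  assumes "x \<in> X" "finite A" "A \<subseteq> E `` {x}"
  shows "good A x (pick A x)"
proof -
  have "\<exists>z \<in> E `` {x} - A. \<forall>B \<in> nsets A (n - 1). c (insert z B) = col x"
    by (rule infinite_color_extend[OF E assms(1) n trans infinite_color_col assms(2,3)]) (rule assms(1))
  then have "\<exists>m. good A x (G m x)"
    using G_range[OF assms(1)] by (auto simp: good_def)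
  then show ?thesis unfolding pick_def by (rule LeastI_ex)
qed

lemma pick_E: "x \<in> X \<Longrightarrow> (x, pick A x) \<in> E"
  by (simp add: pick_def G_E)

text \<open>Measurability of a set-valued map through a sequence of measurable selectors, as in a
  Castaing representation; the values on \<open>X\<close> are then countable and nonempty.\<close>

definition enumerated :: "('a \<Rightarrow> 'a set) \<Rightarrow> bool" where
  "enumerated A \<longleftrightarrow> (\<exists>p::nat \<Rightarrow> 'a \<Rightarrow> 'a. (\<forall>l. p l \<in> M \<rightarrow>\<^sub>M M) \<and> (\<forall>x\<in>X. A x = range (\<lambda>l. p l x)))"

text \<open>An implication for each fixed \<open>q\<close> turns the colour condition into a
  countable conjunction of measurable predicates; the colour of the varying set enters only through
  \<open>color_at\<close>.\<close>

lemma good_iff: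
  assumes x: "x \<in> X" and A: "A = range (\<lambda>l. p l x)"
  shows "good A x (G m x) \<longleftrightarrow>
    (\<forall>l. G m x \<noteq> p l x) \<and> (\<forall>ls q. color_at (G m # map p ls) q x \<longrightarrow> col x = q)"
proof -
  have "(\<forall>B\<in>nsets A (n - 1). c (insert (G m x) B) = col x) \<longleftrightarrow>
      (\<forall>ls q. color_at (G m # map p ls) q x \<longrightarrow> col x = q)" if "G m x \<notin> A"
  proof
    assume *: "\<forall>B\<in>nsets A (n - 1). c (insert (G m x) B) = col x"
    show "\<forall>ls q. color_at (G m # map p ls) q x \<longrightarrow> col x = q"
    proof (intro allI impI)
      fix ls q assume q: "color_at (G m # map p ls) q x"
      then have "length ls = n - 1" "distinct (map (\<lambda>l. p l x) ls)"
        by (auto simp: color_at_def comp_def)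
      then have "set (map (\<lambda>l. p l x) ls) \<in> nsets A (n - 1)"
        unfolding A nsets_range_iff by blast
      then have "c (insert (G m x) (set (map (\<lambda>l. p l x) ls))) = col x" using * by blast
      then show "col x = q" using q by (simp add: color_at_def image_image)
    qed
  next
    assume *: "\<forall>ls q. color_at (G m # map p ls) q x \<longrightarrow> col x = q"
    show "\<forall>B\<in>nsets A (n - 1). c (insert (G m x) B) = col x"
    proof
      fix B assume "B \<in> nsets A (n - 1)"
      then obtain ls where ls: "length ls = n - 1" "distinct (map (\<lambda>l. p l x) ls)" "B = set (map (\<lambda>l. p l x) ls)"
        unfolding A nsets_range_iff by blast
      moreover have "G m x \<notin> set (map (\<lambda>l. p l x) ls)" using that A by auto
      ultimately have "color_at (G m # map p ls) (c (insert (G m x) B)) x"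
        using n by (simp add: color_at_def comp_def image_image)
      then show "c (insert (G m x) B) = col x" using * by metis
    qed
  qed
  moreover have "G m x \<notin> A \<longleftrightarrow> (\<forall>l. G m x \<noteq> p l x)" using A by auto
  ultimately show ?thesis unfolding good_def by blast
qed

lemma pick_measurable:
  assumes A: "enumerated A" and AE: "\<And>x. x \<in> X \<Longrightarrow> A x \<subseteq> E `` {x}"
  shows "(\<lambda>x. pick (A x) x) \<in> M \<rightarrow>\<^sub>M M"
proof -
  obtain p :: "nat \<Rightarrow> 'a \<Rightarrow> 'a" where p: "\<And>l. p l \<in> M \<rightarrow>\<^sub>M M" "\<And>x. x \<in> X \<Longrightarrow> A x = range (\<lambda>l. p l x)"
    using A unfolding enumerated_def by metis
  have pE: "(x, p l x) \<in> E" if "x \<in> X" for x l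
    using p(2)[OF that] AE[OF that] by blast
  have [measurable]: "Measurable.pred M (color_at (G m # map p ls) q)" for m ls q
    by (rule color_at_pred) (auto simp: G_E pE p(1))
  have [measurable]: "Measurable.pred M (\<lambda>x. G m x \<noteq> p l x)" for m l
    using standard_borel_pred_eq[OF M G_meas p(1)] by (rule pred_intros_logic)
  have "Measurable.pred M (\<lambda>x. (\<forall>l. G m x \<noteq> p l x) \<and> (\<forall>ls q. color_at (G m # map p ls) q x \<longrightarrow> col x = q))" for m
    by measurable
  moreover have "good (A x) x (G m x) \<longleftrightarrow>
      (\<forall>l. G m x \<noteq> p l x) \<and> (\<forall>ls q. color_at (G m # map p ls) q x \<longrightarrow> col x = q)" if "x \<in> X" for x m
    by (rule good_iff[where p = p, OF that p(2)[OF that]])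
  ultimately have "Measurable.pred M (\<lambda>x. good (A x) x (G m x))" for m
    by (subst measurable_cong)
  then have "(\<lambda>x. LEAST m. good (A x) x (G m x)) \<in> M \<rightarrow>\<^sub>M count_space UNIV"
    by (rule measurable_Least)
  then show ?thesis
    unfolding pick_def by (rule measurable_compose_countable[rotated]) (rule G_meas)
qed

text \<open>
  \<open>past i x\<close> contains all the points chosen by members of the \<open>F i\<close>-class of \<open>x\<close> before
  stage \<open>i\<close>. The point \<open>x\<close> itself only serves to make \<open>past 0 x\<close> nonempty, so that it can be
  enumerated by measurable functions.
\<close>

primrec past :: "nat \<Rightarrow> 'a \<Rightarrow> 'a set" where
  "past 0 = (\<lambda>x. {x})"
| "past (Suc i) = (\<lambda>x. \<Union>y\<in>F (Suc i) `` {x}. insert (pick (past i (s i y)) (s i y)) (past i y))"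

text \<open>Both the past and the enumeration are taken at \<open>s i x\<close>, so all members of
  an \<open>F i\<close>-class get the same point.\<close>

definition pt :: "nat \<Rightarrow> 'a \<Rightarrow> 'a" where
  "pt i x = pick (past i (s i x)) (s i x)"

lemma s_X: "x \<in> X \<Longrightarrow> s i x \<in> X"
  using measurable_space[OF s_meas] .

lemma pt_E: "x \<in> X \<Longrightarrow> (x, pt i x) \<in> E"
  unfolding pt_def using E_class[OF F_E[OF s_F]] pick_E[OF s_X] by blast

lemma pt_X: "x \<in> X \<Longrightarrow> pt i x \<in> X"
  using pt_E E_X by blast

lemma past_class: "x \<in> X \<Longrightarrow> finite (past i x) \<and> past i x \<subseteq> E `` {x}"
proof (induction i arbitrary: x)
  case 0
  then show ?case using E_refl by simp
next
  case (Suc i)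
  have y: "y \<in> X \<and> E `` {y} = E `` {x}" if "(x, y) \<in> F (Suc i)" for y
    using F_E[OF that] E_X E_class by blast
  have "finite (F (Suc i) `` {x})" using F_fin Suc.prems by (simp add: finite_classes_def)
  then have "finite (past (Suc i) x)" using Suc.IH y by simp
  moreover have "past (Suc i) x \<subseteq> E `` {x}"
    using Suc.IH y pt_E unfolding pt_def by fastforce
  ultimately show ?case by blast
qed

text \<open>Two related points are needed because stage \<open>i\<close> looks at the past of
  \<open>s i x\<close>, not of \<open>x\<close>. In the induction \<open>x\<close> itself
  contributes \<open>past i x\<close> and its latest point to the past of \<open>y\<close>.\<close>

lemma pt_past: "(x, y) \<in> F i \<Longrightarrow> j < i \<Longrightarrow> pt j x \<in> past i y"
proof (induction i arbitrary: x y)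
  case (Suc i)
  have x: "x \<in> X" "(y, x) \<in> F (Suc i)"
    using Suc.prems F[of "Suc i"] by (auto simp: equiv_def dest: symD)
  have "pt j x \<in> insert (pt i x) (past i x)"
    using Suc.IH[OF F_refl[OF x(1)]] Suc.prems(2) by (cases "j = i") auto
  then show ?case using x(2) by (auto simp: pt_def)
qed simp

text \<open>Conditional, because the enumeration of the next past uses measurability of
  \<open>pt i\<close>, which in turn rests on the enumeration of \<open>past i\<close>.\<close>

lemma pt_measurable_if:
  assumes "enumerated (past i)"
  shows "pt i \<in> M \<rightarrow>\<^sub>M M"
proof -
  have "(\<lambda>x. pick (past i x) x) \<in> M \<rightarrow>\<^sub>M M"
    using assms past_class by (intro pick_measurable) auto
  from measurable_compose[OF s_meas this] show ?thesis by (simp add: pt_def[abs_def])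
qed

lemma enumerated_past: "enumerated (past i)"
proof (induction i)
  case 0
  show ?case unfolding enumerated_def by (rule exI[of _ "\<lambda>_ x. x"]) auto
next
  case (Suc i)
  have ptM: "pt i \<in> M \<rightarrow>\<^sub>M M" by (rule pt_measurable_if[OF Suc])
  obtain p :: "nat \<Rightarrow> 'a \<Rightarrow> 'a" where p: "\<And>l. p l \<in> M \<rightarrow>\<^sub>M M" "\<And>x. x \<in> X \<Longrightarrow> past i x = range (\<lambda>l. p l x)"
    using Suc unfolding enumerated_def by metis
  define p' where "p' = case_nat (pt i) p"
  have p': "p' l \<in> M \<rightarrow>\<^sub>M M" for l
    using ptM p(1) by (cases l) (simp_all add: p'_def)
  have p'_range: "range (\<lambda>l. p' l y) = insert (pt i y) (past i y)" if "y \<in> X" for y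
    unfolding p(2)[OF that] by (auto simp: p'_def image_iff split: nat.splits)
  have "past (Suc i) x = range (\<lambda>l. p' (snd (prod_decode l)) (g (Suc i) (fst (prod_decode l)) x))"
    if x: "x \<in> X" for x
  proof -
    have y: "y \<in> X" if "y \<in> F (Suc i) `` {x}" for y
      using F_E that E_X by blast
    have "past (Suc i) x = (\<Union>y\<in>F (Suc i) `` {x}. range (\<lambda>l. p' l y))"
      using p'_range y by (auto simp: pt_def)
    also have "\<dots> = (\<Union>m. range (\<lambda>l. p' l (g (Suc i) m x)))"
      unfolding g_range[OF x] by simp
    also have "\<dots> = range (\<lambda>l. p' (snd (prod_decode l)) (g (Suc i) (fst (prod_decode l)) x))"
    proof (intro equalityI subsetI)
      fix z assume "z \<in> (\<Union>m. range (\<lambda>l. p' l (g (Suc i) m x)))"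
      then obtain m l where "z = p' l (g (Suc i) m x)" by blast
      then show "z \<in> range (\<lambda>l. p' (snd (prod_decode l)) (g (Suc i) (fst (prod_decode l)) x))"
        by (intro image_eqI[of _ _ "prod_encode (m, l)"]) auto
    qed blast
    finally show ?thesis .
  qed
  then show ?case
    unfolding enumerated_def
    using measurable_compose[OF g_meas p']
    by (intro exI[of _ "\<lambda>l x. p' (snd (prod_decode l)) (g (Suc i) (fst (prod_decode l)) x)"]) auto
qed

lemma pt_measurable: "pt i \<in> M \<rightarrow>\<^sub>M M"
  by (rule pt_measurable_if[OF enumerated_past])

section \<open>Injectivity, homogeneity and reduction to \<open>E1\<close>\<close>

lemma pt_good:
  assumes x: "x \<in> X"
  shows "good (past i (s i x)) x (pt i x)"
proof -
  have "col (s i x) = col x" using col_E[OF F_E[OF s_F[OF x]]] by simp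
  then show ?thesis
    using good_pick[OF s_X[OF x]] past_class[OF s_X[OF x]] by (simp add: good_def pt_def)
qed

lemma pt_inj: "x \<in> X \<Longrightarrow> inj (\<lambda>i. pt i x)"
proof -
  assume x: "x \<in> X"
  have "pt i x \<noteq> pt j x" if "j < i" for i j
    using pt_good[OF x, of i] pt_past[OF s_F[OF x] that] by (auto simp: good_def)
  then show ?thesis by (intro linorder_injI) metis
qed

lemma pt_monochromatic:
  assumes x: "x \<in> X" and B: "B \<in> nsets (range (\<lambda>i. pt i x)) n"
  shows "c B = col x"
proof -
  obtain J where J: "B = (\<lambda>i. pt i x) ` J" using B by (auto simp: nsets_def subset_image_iff)
  have inj: "inj_on (\<lambda>i. pt i x) J" for J using pt_inj[OF x] by (rule inj_on_subset) simp
  have fin: "finite J" and card: "card J = n"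
    using B inj by (auto simp: J nsets_def card_image finite_image_iff)
  \<comment> \<open>The stage at which the last member of \<open>B\<close> was chosen; the other
    members lie in the past used there.\<close>
  define i where "i = Max J"
  have iJ: "i \<in> J" using fin card n by (auto simp: i_def intro!: Max_in)
  have less: "j < i" if "j \<in> J - {i}" for j
    using that fin Max_ge[of J j] by (auto simp: i_def less_le)
  have "(\<lambda>i. pt i x) ` (J - {i}) \<in> nsets (past i (s i x)) (n - 1)"
    using less pt_past[OF s_F[OF x]] fin card iJ inj by (auto simp: nsets_def card_image)
  then have "c (insert (pt i x) ((\<lambda>i. pt i x) ` (J - {i}))) = col x"
    using pt_good[OF x, of i] by (simp add: good_def)
  moreover have "insert (pt i x) ((\<lambda>i. pt i x) ` (J - {i})) = B" using iJ J by blast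
  ultimately show ?thesis by simp
qed

lemma pt_E1:
  assumes x: "x \<in> X" and y: "y \<in> X"
  shows "(x, y) \<in> E \<longleftrightarrow> (\<lambda>i. pt i x, \<lambda>i. pt i y) \<in> E1 X"
proof
  assume "(x, y) \<in> E"
  then obtain i where "(x, y) \<in> F i" using F_Un by blast
  then have F_j: "(x, y) \<in> F j" if "j \<ge> i" for j using incseqD[OF F_mono that] by blast
  have "pt j x = pt j y" if "j \<ge> i" for j using s_eq[OF F_j[OF that]] by (simp add: pt_def)
  then show "(\<lambda>i. pt i x, \<lambda>i. pt i y) \<in> E1 X"
    using pt_X x y by (auto simp: E1_def)
next
  assume "(\<lambda>i. pt i x, \<lambda>i. pt i y) \<in> E1 X"
  \<comment> \<open>A single agreement suffices, since each chosen point lies in the class of the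
    point it was chosen for.\<close>
  then obtain i where "pt i x = pt i y" by (auto simp: E1_def)
  then have "(x, pt i x) \<in> E" "(y, pt i x) \<in> E" using pt_E[OF x, of i] pt_E[OF y, of i] by simp_all
  then have "E `` {x} = E `` {y}" using E_class by blast
  then show "(x, y) \<in> E" using E_refl[OF y] by blast
qed

lemma monochromatic_reduction_pt: "monochromatic_reduction X E n c (\<lambda>x i. pt i x)"
  unfolding monochromatic_reduction_def
proof (intro conjI ballI allI impI)
  show "(\<lambda>x i. pt i x) \<in> X \<rightarrow> (UNIV \<rightarrow> X)" using pt_X by blast
  show "pt i x \<noteq> pt j x" if "x \<in> X" "i \<noteq> j" for x i j
    using injD[OF pt_inj[OF that(1)]] that(2) by blast
  show "range (\<lambda>i. pt i x) \<subseteq> E `` {x}" if "x \<in> X" for x using pt_E[OF that] by blast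
  show "c B = c B'" if "x \<in> X" "B \<in> nsets (range (\<lambda>i. pt i x)) n" "B' \<in> nsets (range (\<lambda>i. pt i x)) n" for x B B'
    using pt_monochromatic that by simp
  show "((x, y) \<in> E) = ((\<lambda>i. pt i x, \<lambda>i. pt i y) \<in> E1 X)" if "x \<in> X" "y \<in> X" for x y
    by (rule pt_E1[OF that])
qed

lemma borel_pt: "(\<lambda>x i. pt i x) \<in> M \<rightarrow>\<^sub>M Pi\<^sub>M UNIV (\<lambda>_. M)"
  using pt_X by (intro measurable_PiM_single' pt_measurable) (auto simp: PiE_UNIV_domain)

end

theorem theorem3p4:
  fixes M :: "'a measure" and R E :: "'a rel" and n k :: nat and c :: "'a set \<Rightarrow> nat"
  assumes "standard_borel M"
    and "borel_linear_order M R"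
    and "hyperfinite M E"
    and "aperiodic (space M) E"
    and "n \<ge> 1" and "k \<ge> 1"
    and "borel_coloring M R E n k c"
    and "almost_transitive (space M) E n c"
  shows "\<exists>S :: 'a \<Rightarrow> nat \<Rightarrow> 'a. S \<in> M \<rightarrow>\<^sub>M Pi\<^sub>M UNIV (\<lambda>_. M) \<and>
           monochromatic_reduction (space M) E n c S"
proof -
  obtain F where F: "incseq F" "\<And>i. borel_equiv M (F i)" "\<And>i. finite_classes (space M) (F i)"
      "E = (\<Union>i::nat. F i)" and E: "equiv (space M) E"
    using assms(3) unfolding hyperfinite_def borel_equiv_def by metis
  obtain G :: "nat \<Rightarrow> 'a \<Rightarrow> 'a" where G: "\<And>m. G m \<in> M \<rightarrow>\<^sub>M M"
      "\<And>x. x \<in> space M \<Longrightarrow> E `` {x} = range (\<lambda>m. G m x)"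
    using hyperfinite_enumeration[OF assms(1,3)] by metis
  have "\<exists>(g :: nat \<Rightarrow> 'a \<Rightarrow> 'a) s. (\<forall>j. g j \<in> M \<rightarrow>\<^sub>M M) \<and> (\<forall>x\<in>space M. F i `` {x} = range (\<lambda>j. g j x)) \<and>
      s \<in> M \<rightarrow>\<^sub>M M \<and> (\<forall>x\<in>space M. (x, s x) \<in> F i) \<and> (\<forall>x y. (x, y) \<in> F i \<longrightarrow> s x = s y)" for i
    by (rule finite_borel_equiv_enumeration[OF assms(1) F(2,3), of i]) blast
  then obtain g :: "nat \<Rightarrow> nat \<Rightarrow> 'a \<Rightarrow> 'a" and s where
    "\<And>i j. g i j \<in> M \<rightarrow>\<^sub>M M" "\<And>i x. x \<in> space M \<Longrightarrow> F i `` {x} = range (\<lambda>j. g i j x)"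
    "\<And>i. s i \<in> M \<rightarrow>\<^sub>M M" "\<And>i x. x \<in> space M \<Longrightarrow> (x, s i x) \<in> F i"
    "\<And>i x y. (x, y) \<in> F i \<Longrightarrow> s i x = s i y"
    by metis
  then interpret hyperfinite_coloring M R E n k c F G g s
    using assms F G E by unfold_locales (auto simp: borel_equiv_def)
  show ?thesis using borel_pt monochromatic_reduction_pt by blast
qed

end
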